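(* Let $\mathcal A=\{a_1,\ldots,a_n\}\subset\mathbb N^m$ be a list of nonzero vectors. Then $I_{\mathcal A}$ is a complete intersection if and only if either $\mathcal A_{red}=\emptyset$ or $I_{\mathcal A_{red}}$ is a complete intersection.
   Context: $k$ is an arbitrary field. For a finite list $\mathcal A=\{a_1,\ldots,a_n\}$ of nonzero vectors in $\mathbb N^m$, the toric ideal $I_{\mathcal A}\subset k[x_1,\ldots,x_n]$ is the kernel of the $k$-algebra homomorphism $x_i\mapsto t^{a_i}=t_1^{a_{i1}}\cdots t_m^{a_{im}}$ into $k[t_1,\ldots,t_m]$; its height is $n-\mathrm{rk}(\mathbb Z\mathcal A)$. An ideal is a complete intersection if its minimal number of generators equals its height. For a finite set $S$ of vectors, $\mathbb N S,\mathbb Z S,\mathbb Q S$ denote the sets of their nonnegative integer, integer and rational linear combinations. The reduced set $\mathcal A_{red}$ is the output of the following procedure: set $R:=\mathcal A$. Repeat: set $G:=R$; for each $a\in G$ in turn: remove $a$ from $R$; if $a\in\mathbb Q R$, let $B:=\min\{b\in\mathbb Z^+ : b\,a\in\mathbb Z R\}$ and, if $B\,a\notin\mathbb N R$, put $B\,a$ into $R$ (if $a\notin\mathbb QR$, or $B a\in\mathbb NR$, $a$ stays removed). Stop repeating when $R=\emptyset$ or $R=G$; then $\mathcal A_{red}:=R$. When nonempty, $\mathcal A_{red}=\{a'_1,\ldots,a'_r\}$ with $r\le n$ and $I_{\mathcal A_{red}}\subset k[x_1,\ldots,x_r]$ is its toric ideal. *)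

theory Defs
  imports Complex_Main "HOL-Library.Poly_Mapping"
begin

(* Vectors of N^m are represented as lists of naturals of length m.
   Linear combinations over a finite set S of such vectors, coordinatewise. *)

definition inQspan :: "nat \<Rightarrow> nat list set \<Rightarrow> nat list \<Rightarrow> bool" where
  "inQspan m S v \<longleftrightarrow> (\<exists>c :: nat list \<Rightarrow> rat.
      \<forall>j<m. of_nat (v ! j) = (\<Sum>b\<in>S. c b * of_nat (b ! j)))"

definition inZspan :: "nat \<Rightarrow> nat list set \<Rightarrow> nat list \<Rightarrow> bool" where
  "inZspan m S v \<longleftrightarrow> (\<exists>c :: nat list \<Rightarrow> int.
      \<forall>j<m. int (v ! j) = (\<Sum>b\<in>S. c b * int (b ! j)))"

definition inNspan :: "nat \<Rightarrow> nat list set \<Rightarrow> nat list \<Rightarrow> bool" where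
  "inNspan m S v \<longleftrightarrow> (\<exists>c :: nat list \<Rightarrow> nat.
      \<forall>j<m. v ! j = (\<Sum>b\<in>S. c b * b ! j))"

definition scaleN :: "nat \<Rightarrow> nat list \<Rightarrow> nat list" where
  "scaleN b a = map (\<lambda>x. b * x) a"

definition minB :: "nat \<Rightarrow> nat list set \<Rightarrow> nat list \<Rightarrow> nat" where
  "minB m S a = (LEAST b. b > 0 \<and> inZspan m S (scaleN b a))"

definition red_step :: "nat \<Rightarrow> nat list \<Rightarrow> nat list list \<Rightarrow> nat list list" where
  "red_step m a R =
     (let R' = remove1 a R; B = minB m (set R') a in
      if inQspan m (set R') a \<and> \<not> inNspan m (set R') (scaleN B a)
      then R' @ [scaleN B a] else R')"

definition red_pass :: "nat \<Rightarrow> nat list list \<Rightarrow> nat list list" where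
  "red_pass m G = fold (red_step m) G G"

definition reduced :: "nat \<Rightarrow> nat list list \<Rightarrow> nat list list" where
  "reduced m A =
     (let it = (\<lambda>k. (red_pass m ^^ k) A);
          k0 = (LEAST k. k \<ge> 1 \<and> (it k = [] \<or> set (it k) = set (it (k - 1))))
      in it k0)"

(* Polynomials: (nat \<Rightarrow>\<^sub>0 nat) \<Rightarrow>\<^sub>0 'k, monomials are exponent vectors.
   k[x_0,...,x_{n-1}] = polynomials only involving variables < n. *)
definition polyring :: "nat \<Rightarrow> ((nat \<Rightarrow>\<^sub>0 nat) \<Rightarrow>\<^sub>0 'k::field) set" where
  "polyring n = {p. \<forall>\<mu>\<in>Poly_Mapping.keys p. Poly_Mapping.keys \<mu> \<subseteq> {..<n}}"

(* the k-algebra homomorphism x_i \<mapsto> t^(a_i) into k[t_0,...,t_{m-1}] *)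
definition toric_hom :: "nat list list \<Rightarrow> ((nat \<Rightarrow>\<^sub>0 nat) \<Rightarrow>\<^sub>0 'k::field)
                          \<Rightarrow> ((nat \<Rightarrow>\<^sub>0 nat) \<Rightarrow>\<^sub>0 'k)" where
  "toric_hom A p = (\<Sum>\<mu>\<in>Poly_Mapping.keys p. Poly_Mapping.single 0 (Poly_Mapping.lookup p \<mu>) *
       (\<Prod>i\<in>Poly_Mapping.keys \<mu>. (Poly_Mapping.single (Poly_Mapping.nth (A ! i)) 1) ^ Poly_Mapping.lookup \<mu> i))"

definition toric_ideal :: "nat list list \<Rightarrow> ((nat \<Rightarrow>\<^sub>0 nat) \<Rightarrow>\<^sub>0 'k::field) set" where
  "toric_ideal A = {p \<in> polyring (length A). toric_hom A p = 0}"

definition gen_ideal :: "nat \<Rightarrow> ((nat \<Rightarrow>\<^sub>0 nat) \<Rightarrow>\<^sub>0 'k::field) set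
                          \<Rightarrow> ((nat \<Rightarrow>\<^sub>0 nat) \<Rightarrow>\<^sub>0 'k) set" where
  "gen_ideal n G = {\<Sum>g\<in>G. h g * g | h. \<forall>g\<in>G. h g \<in> polyring n}"

definition min_gens :: "nat \<Rightarrow> ((nat \<Rightarrow>\<^sub>0 nat) \<Rightarrow>\<^sub>0 'k::field) set \<Rightarrow> nat" where
  "min_gens n I = (LEAST c. \<exists>G. finite G \<and> G \<subseteq> polyring n \<and> card G = c \<and> gen_ideal n G = I)"

definition lin_indep_Q :: "nat \<Rightarrow> nat list set \<Rightarrow> bool" where
  "lin_indep_Q m T \<longleftrightarrow> (\<forall>c :: nat list \<Rightarrow> rat.
      (\<forall>j<m. (\<Sum>b\<in>T. c b * of_nat (b ! j)) = 0) \<longrightarrow> (\<forall>b\<in>T. c b = 0))"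

definition lattice_rank :: "nat \<Rightarrow> nat list list \<Rightarrow> nat" where
  "lattice_rank m A = Max {card T | T. T \<subseteq> set A \<and> lin_indep_Q m T}"

(* I_A is a complete intersection: minimal number of generators = height = n - rk(Z A) *)
definition toric_ci :: "'k::field itself \<Rightarrow> nat \<Rightarrow> nat list list \<Rightarrow> bool" where
  "toric_ci _ m A \<longleftrightarrow>
     min_gens (length A) (toric_ideal A :: ((nat \<Rightarrow>\<^sub>0 nat) \<Rightarrow>\<^sub>0 'k) set)
       = length A - lattice_rank m A"

end

theory Submission
  imports Defs "HOL-Combinatorics.Permutations"
begin

text \<open>
  By graded Nakayama, which needs all vectors to be nonzero, the minimal number \<open>\<mu>(I\<^sub>A)\<close> of
  generators is the dimension of \<open>I\<^sub>A / \<mm> I\<^sub>A\<close>. Here \<open>I\<^sub>A\<close> is spanned by the binomials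
  \<open>x\<^sup>u - x\<^sup>v\<close> with \<open>u\<close>, \<open>v\<close> of equal \<open>A\<close>-degree, and \<open>\<mm> I\<^sub>A\<close> by those whose two
  monomials have a common variable, so linear maps induced by maps of monomials compare \<open>\<mu>\<close> for
  different lists. Let \<open>B\<close> be the least positive integer with \<open>B a \<in> \<int>A\<close>. If
  \<open>a \<notin> \<rat>A\<close>, appending \<open>a\<close> to \<open>A\<close> does not change \<open>\<mu>\<close>. Otherwise the last exponents of \<open>u\<close> and
  \<open>v\<close> agree modulo \<open>B\<close>, so \<open>x\<^sub>n \<mapsto> x\<^sub>n\<^sup>B\<close> shows that \<open>a\<close> and \<open>B a\<close> are
  interchangeable. If moreover \<open>B a \<in> \<nat>A\<close>, appending \<open>B a\<close> raises \<open>\<mu>\<close> by exactly one, the new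
  generator being \<open>x\<^sub>n - x\<^sup>w\<close>. Comparing with the ranks, every single reduction step preserves
  being a complete intersection; the stopping rule of the reduction plays no role.
\<close>

section \<open>Linear maps between polynomial rings\<close>

type_synonym 'k mpol = "(nat \<Rightarrow>\<^sub>0 nat) \<Rightarrow>\<^sub>0 'k"

abbreviation lookup where "lookup \<equiv> Poly_Mapping.lookup"
abbreviation keys where "keys \<equiv> Poly_Mapping.keys"
abbreviation single where "single \<equiv> Poly_Mapping.single"

text \<open>Scaling is multiplication by a constant polynomial, the form in which coefficients enter
  \<open>toric_hom\<close>. The index type is left general because the same vector space structure
  later carries the rational vectors \<open>vec a\<close>.\<close>

definition scl :: "'k::field \<Rightarrow> ('a::comm_monoid_add \<Rightarrow>\<^sub>0 'k) \<Rightarrow> ('a \<Rightarrow>\<^sub>0 'k)" where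
  "scl c p = single 0 c * p"

lemma lookup_scl [simp]: "lookup (scl c p) u = c * lookup p u"
  unfolding scl_def mult_map_scale_conv_mult[symmetric]
  by (simp add: Poly_Mapping.map.rep_eq when_def)

lemma scl_single [simp]: "scl c (single u d) = single u (c * d)"
  by (simp add: scl_def mult_single)

interpretation vs: vector_space "scl :: 'k::field \<Rightarrow> ('a::comm_monoid_add \<Rightarrow>\<^sub>0 'k) \<Rightarrow> _"
  by unfold_locales
    (auto intro!: poly_mapping_eqI simp: lookup_add algebra_simps)

interpretation vp: vector_space_pair
  "scl :: 'k::field \<Rightarrow> ('a::comm_monoid_add \<Rightarrow>\<^sub>0 'k) \<Rightarrow> _"
  "scl :: 'k::field \<Rightarrow> ('b::comm_monoid_add \<Rightarrow>\<^sub>0 'k) \<Rightarrow> _"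
  by unfold_locales

abbreviation lin :: "(('a::comm_monoid_add \<Rightarrow>\<^sub>0 'k::field) \<Rightarrow> ('b::comm_monoid_add \<Rightarrow>\<^sub>0 'k)) \<Rightarrow> bool" where
  "lin \<equiv> Vector_Spaces.linear scl scl"

lemma linI:
  assumes "\<And>p q. f (p + q) = f p + f q" "\<And>c p. f (scl c p) = scl c (f p)"
  shows "lin f"
  using assms by (simp add: Vector_Spaces.linear_iff vs.vector_space_axioms)

lemma lin_diff: "lin f \<Longrightarrow> f (p - q) = f p - f q"
  by (rule vp.linear_diff)

lemma lin_span_image: "lin f \<Longrightarrow> vs.span (f ` S) = f ` vs.span S"
  by (rule vp.linear_span_image)

lemma lin_span_image_subspace:
  assumes "lin f" "f ` S \<subseteq> J" "vs.subspace J" "p \<in> vs.span S"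
  shows "f p \<in> J"
  using assms(1,4) lin_span_image[of f S] vs.span_minimal[OF assms(2,3)] by auto

lemma lin_span_image_subset:
  assumes "lin f" "f ` S \<subseteq> vs.span T" "p \<in> vs.span S"
  shows "f p \<in> vs.span T"
  using lin_span_image_subspace[OF assms(1,2) vs.subspace_span assms(3)] .

text \<open>The linear extension of a map given on the basis of monomials.\<close>

definition ext :: "('a \<Rightarrow> 'b \<Rightarrow>\<^sub>0 'k) \<Rightarrow> ('a \<Rightarrow>\<^sub>0 'k::field) \<Rightarrow> ('b::comm_monoid_add \<Rightarrow>\<^sub>0 'k)" where
  "ext f p = (\<Sum>u\<in>keys p. scl (lookup p u) (f u))"

lemma ext_superset:
  assumes "finite K" "keys p \<subseteq> K"
  shows "ext f p = (\<Sum>u\<in>K. scl (lookup p u) (f u))"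
  unfolding ext_def
  by (rule sum.mono_neutral_left) (use assms in \<open>auto simp: in_keys_iff\<close>)

lemma lin_ext: "lin (ext f :: ('a::comm_monoid_add \<Rightarrow>\<^sub>0 'k::field) \<Rightarrow> ('b::comm_monoid_add \<Rightarrow>\<^sub>0 'k))"
proof (rule linI)
  fix p q :: "'a \<Rightarrow>\<^sub>0 'k" and c
  let ?K = "keys p \<union> keys q"
  have "ext f (p + q) = (\<Sum>u\<in>?K. scl (lookup (p + q) u) (f u))"
    by (rule ext_superset) (use Poly_Mapping.keys_add[of p q] in auto)
  also have "\<dots> = (\<Sum>u\<in>?K. scl (lookup p u) (f u)) + (\<Sum>u\<in>?K. scl (lookup q u) (f u))"
    by (simp add: lookup_add vs.scale_left_distrib sum.distrib)
  also have "\<dots> = ext f p + ext f q"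
    by (simp add: ext_superset[of ?K])
  finally show "ext f (p + q) = ext f p + ext f q" .
  have "ext f (scl c p) = (\<Sum>u\<in>keys p. scl (lookup (scl c p) u) (f u))"
    by (rule ext_superset) (auto simp: in_keys_iff)
  also have "\<dots> = scl c (ext f p)"
    by (simp add: ext_def vs.scale_sum_right)
  finally show "ext f (scl c p) = scl c (ext f p)" .
qed

lemma ext_single [simp]: "ext f (single u c) = scl c (f u)"
  by (cases "c = 0") (auto simp: ext_def)

lemma ext_monomials: "ext (\<lambda>u. single u 1) p = p"
  by (rule poly_mapping_eqI) 
    (auto simp: ext_def lookup_sum lookup_single when_def in_keys_iff)

text \<open>Steinitz exchange in the quotient by \<open>span W\<close>, carried out without forming
  the quotient. It serves to replace arbitrary spanning polynomials by binomials.\<close>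

lemma exchange_mod_subspace:
  fixes S B W :: "('a::comm_monoid_add \<Rightarrow>\<^sub>0 'k::field) set"
  assumes "finite S" "B \<subseteq> vs.span (S \<union> W)"
  obtains T where "T \<subseteq> B" "finite T" "card T \<le> card S" "B \<subseteq> vs.span (T \<union> W)"
proof -
  obtain C where C: "C \<subseteq> W" "vs.independent C" "W \<subseteq> vs.span C"
    using vs.maximal_independent_subset by blast
  obtain D where D: "C \<subseteq> D" "D \<subseteq> C \<union> B" "vs.independent D" "C \<union> B \<subseteq> vs.span D"
    using vs.maximal_independent_subset_extend[of C "C \<union> B"] C by auto
  define T where "T = D - C"
  \<comment> \<open>On \<open>D\<close> this projection kills \<open>C\<close> and fixes
    \<open>T\<close>. It therefore kills \<open>W\<close> and acts as the quotient map, so that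
    \<open>T\<close> falls into the span of the image of \<open>S\<close>.\<close>
  obtain \<pi> where \<pi>: "lin \<pi>" "\<forall>x\<in>D. \<pi> x = (if x \<in> C then 0 else x)"
    using vp.linear_independent_extend[OF D(3), of "\<lambda>x. if x \<in> C then 0 else x"] by blast
  have "\<pi> x = 0" if "x \<in> W" for x
  proof -
    have "\<pi> x \<in> vs.span {}"
      by (rule lin_span_image_subset[of _ C]) (use \<pi> C D that in auto)
    then show ?thesis by simp
  qed
  then have "\<pi> ` (S \<union> W) \<subseteq> insert 0 (\<pi> ` S)" by auto
  then have sp: "\<pi> ` (S \<union> W) \<subseteq> vs.span (\<pi> ` S)"
    using vs.span_superset[of "insert 0 (\<pi> ` S)"] by (auto simp only: vs.span_insert_0)
  have "T \<subseteq> vs.span (\<pi> ` S)"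
  proof
    fix x assume x: "x \<in> T"
    then have "\<pi> x = x" "x \<in> B" using \<pi> D unfolding T_def by auto
    with lin_span_image_subset[OF \<pi>(1) sp, of x] assms(2) show "x \<in> vs.span (\<pi> ` S)" by auto
  qed
  moreover have "vs.independent T"
    using D(3) vs.independent_mono unfolding T_def by blast
  ultimately have "finite T" "card T \<le> card (\<pi> ` S)"
    using vs.independent_span_bound[of "\<pi> ` S" T] assms(1) by auto
  moreover have "card (\<pi> ` S) \<le> card S" using assms(1) by (rule card_image_le)
  moreover have "T \<subseteq> B" using D unfolding T_def by auto
  moreover have "B \<subseteq> vs.span (T \<union> W)"
    using D(4) vs.span_mono[of D "T \<union> W"] C(1) unfolding T_def by blast
  ultimately show thesis using that[of T] by simp
qed

section \<open>Toric ideals and binomials\<close>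

lemma ext_ext: "ext g (ext f p) = ext (\<lambda>u. ext g (f u)) p"
  for f :: "'a::comm_monoid_add \<Rightarrow> 'b::comm_monoid_add \<Rightarrow>\<^sub>0 'k::field"
    and g :: "'b \<Rightarrow> 'c::comm_monoid_add \<Rightarrow>\<^sub>0 'k"
proof -
  have "ext g (ext f p) = (\<Sum>u\<in>keys p. ext g (scl (lookup p u) (f u)))"
    unfolding ext_def[of f] by (rule vp.linear_sum[OF lin_ext])
  also have "\<dots> = (\<Sum>u\<in>keys p. scl (lookup p u) (ext g (f u)))"
    by (simp add: vp.linear_scale[OF lin_ext])
  finally show ?thesis by (simp add: ext_def)
qed

text \<open>The \<open>j\<close>-th coordinate of the \<open>A\<close>-degree. Summing over all
  indices of the list makes additivity immediate, and \<open>nth_default\<close> matches the zero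
  padding of \<open>Poly_Mapping.nth\<close>.\<close>

definition tdeg :: "nat list list \<Rightarrow> (nat \<Rightarrow>\<^sub>0 nat) \<Rightarrow> nat \<Rightarrow> nat" where
  "tdeg A u j = (\<Sum>i<length A. lookup u i * nth_default 0 (A ! i) j)"

lemma tdeg_add: "tdeg A (u + v) j = tdeg A u j + tdeg A v j"
  by (simp add: tdeg_def lookup_add algebra_simps sum.distrib)

lemma tdeg_zero [simp]: "tdeg A 0 j = 0"
  by (simp add: tdeg_def)

text \<open>The exponent of the image monomial, in the form in which \<open>toric_hom\<close>
  produces it. Its agreement with \<open>tdeg\<close> is available for monomials in the first
  \<open>length A\<close> variables.\<close>

definition edeg :: "nat list list \<Rightarrow> (nat \<Rightarrow>\<^sub>0 nat) \<Rightarrow> (nat \<Rightarrow>\<^sub>0 nat)" where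
  "edeg A u = (\<Sum>i\<in>keys u. \<Sum>_<lookup u i. Poly_Mapping.nth (A ! i))"

lemma lookup_edeg:
  assumes "keys u \<subseteq> {..<length A}"
  shows "lookup (edeg A u) = tdeg A u"
proof
  fix j
  have "lookup (edeg A u) j = (\<Sum>i\<in>keys u. lookup u i * nth_default 0 (A ! i) j)"
    by (simp add: edeg_def lookup_sum del: sum_constant) simp
  also have "\<dots> = tdeg A u j"
    unfolding tdeg_def by (rule sum.mono_neutral_left) (use assms in \<open>auto simp: in_keys_iff\<close>)
  finally show "lookup (edeg A u) j = tdeg A u j" .
qed

lemma single_power: "single v (1::'k::field) ^ k = single (\<Sum>_<k. v) 1"
  by (induction k) (simp_all add: mult_single algebra_simps)

lemma prod_single: "finite I \<Longrightarrow> (\<Prod>i\<in>I. single (f i) (1::'k::field)) = single (\<Sum>i\<in>I. f i) 1"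
  by (induction I rule: finite_induct) (simp_all add: mult_single)

lemma toric_hom_eq_ext: "toric_hom A p = ext (\<lambda>u. single (edeg A u) 1) p"
  by (simp add: toric_hom_def ext_def scl_def single_power prod_single edeg_def)

lemma polyring_add: "p \<in> polyring n \<Longrightarrow> q \<in> polyring n \<Longrightarrow> p + q \<in> polyring n"
  unfolding polyring_def using Poly_Mapping.keys_add[of p q] by fastforce

lemma polyring_mult: 
  assumes "p \<in> polyring n" "q \<in> polyring n" shows "p * q \<in> polyring n"
proof -
  have "keys u \<subseteq> {..<n}" if u: "u \<in> keys (p * q)" for u
  proof -
    obtain a b where ab: "u = a + b" "a \<in> keys p" "b \<in> keys q"
      using Poly_Mapping.keys_mult[of p q] u by blast
    then show ?thesis using assms Poly_Mapping.keys_add[of a b] unfolding polyring_def by blast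
  qed
  then show ?thesis by (simp add: polyring_def)
qed

lemma polyring_single [simp]: "keys u \<subseteq> {..<n} \<Longrightarrow> single u c \<in> polyring n"
  by (simp add: polyring_def)

lemma polyring_zero [simp]: "0 \<in> polyring n"
  by (simp add: polyring_def)

lemma polyring_one [simp]: "1 \<in> polyring n"
  by (simp add: polyring_def)

lemma polyring_scl: "p \<in> polyring n \<Longrightarrow> scl c p \<in> polyring n"
  unfolding scl_def by (rule polyring_mult) auto

lemma subspace_polyring: "vs.subspace (polyring n)"
  by (auto simp: vs.subspace_def polyring_add polyring_scl)

definition bin :: "(nat \<Rightarrow>\<^sub>0 nat) \<Rightarrow> (nat \<Rightarrow>\<^sub>0 nat) \<Rightarrow> 'k::field mpol" where
  "bin u v = single u 1 - single v 1"

definition equideg :: "nat list list \<Rightarrow> (nat \<Rightarrow>\<^sub>0 nat) \<Rightarrow> (nat \<Rightarrow>\<^sub>0 nat) \<Rightarrow> bool" where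
  "equideg A u v \<longleftrightarrow> keys u \<subseteq> {..<length A} \<and> keys v \<subseteq> {..<length A} \<and> tdeg A u = tdeg A v"

definition bins :: "nat list list \<Rightarrow> 'k::field mpol set" where
  "bins A = {bin u v | u v. equideg A u v}"

text \<open>Spans \<open>\<mm> I\<^sub>A\<close>: multiplying a binomial by a nontrivial monomial
  creates a common variable, and conversely a common variable can be cancelled from both
  monomials.\<close>

definition sbins :: "nat list list \<Rightarrow> 'k::field mpol set" where
  "sbins A = {bin u v | u v. equideg A u v \<and> keys u \<inter> keys v \<noteq> {}}"

lemma sbins_subset_bins: "sbins A \<subseteq> bins A"
  by (auto simp: sbins_def bins_def)

lemma bin_self [simp]: "bin u u = 0"
  by (simp add: bin_def)

lemma bin_in_bins: "equideg A u v \<Longrightarrow> bin u v \<in> bins A"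
  by (auto simp: bins_def)

lemma bin_in_sbins: "equideg A u v \<Longrightarrow> i \<in> keys u \<Longrightarrow> i \<in> keys v \<Longrightarrow> bin u v \<in> sbins A"
  by (auto simp: sbins_def)

lemma ext_bin: "ext f (bin u v) = f u - f v"
  by (simp add: bin_def lin_diff[OF lin_ext])

lemma bin_in_polyring:
  assumes "equideg A u v" shows "bin u v \<in> polyring (length A)"
  using assms unfolding bin_def equideg_def
  by (intro vs.subspace_diff[OF subspace_polyring]) auto

lemma subspace_toric_ideal: "vs.subspace (toric_ideal A)"
  using subspace_polyring[of "length A"]
  by (auto simp: toric_ideal_def toric_hom_eq_ext vs.subspace_def vp.linear_add[OF lin_ext]
      vp.linear_scale[OF lin_ext] vp.linear_0[OF lin_ext])

text \<open>Fix one monomial in each degree that occurs. Replacing every monomial by the one chosen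
  in its degree factors through \<open>toric_hom\<close>, so it sends \<open>p\<close> to 0; and
  \<open>p\<close> minus its image under this replacement is a combination of binomials.\<close>

lemma toric_ideal_eq_span_bins: "(toric_ideal A :: 'k::field mpol set) = vs.span (bins A)"
proof
  let ?n = "length A"
  have "toric_hom A (bin u v :: 'k mpol) = 0" if "equideg A u v" for u v
  proof -
    have "lookup (edeg A u) = lookup (edeg A v)"
      using that by (simp add: equideg_def lookup_edeg)
    then have "edeg A u = edeg A v" by (simp add: poly_mapping.lookup_inject)
    then show ?thesis by (simp add: toric_hom_eq_ext ext_bin)
  qed
  then have "bins A \<subseteq> (toric_ideal A :: 'k mpol set)"
    using bin_in_polyring by (auto simp: toric_ideal_def bins_def)
  then show "vs.span (bins A) \<subseteq> (toric_ideal A :: 'k mpol set)"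
    by (rule vs.span_minimal[OF _ subspace_toric_ideal])
  show "(toric_ideal A :: 'k mpol set) \<subseteq> vs.span (bins A)"
  proof
    fix p :: "'k mpol" assume p: "p \<in> toric_ideal A"
    define r where "r d = (SOME u. keys u \<subseteq> {..<?n} \<and> edeg A u = d)" for d
    have r: "keys (r (edeg A u)) \<subseteq> {..<?n} \<and> edeg A (r (edeg A u)) = edeg A u"
      if "keys u \<subseteq> {..<?n}" for u
      unfolding r_def by (rule someI[of _ u]) (use that in auto)
    have "ext (\<lambda>u. single (r (edeg A u)) 1) p = ext (\<lambda>d. single (r d) 1) (toric_hom A p)"
      by (simp add: toric_hom_eq_ext ext_ext)
    also have "\<dots> = 0"
      using p by (simp add: toric_ideal_def vp.linear_0[OF lin_ext])
    finally have "p = ext (\<lambda>u. single u 1) p - ext (\<lambda>u. single (r (edeg A u)) 1) p"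
      by (simp add: ext_monomials)
    also have "\<dots> = (\<Sum>u\<in>keys p. scl (lookup p u) (bin u (r (edeg A u))))"
      unfolding ext_def bin_def by (simp add: sum_subtractf vs.scale_right_diff_distrib)
    also have "\<dots> \<in> vs.span (bins A)"
    proof (intro vs.span_sum vs.span_scale vs.span_base)
      fix u assume "u \<in> keys p"
      then have u: "keys u \<subseteq> {..<?n}" using p by (auto simp: toric_ideal_def polyring_def)
      then have "tdeg A u = tdeg A (r (edeg A u))"
        using u r[OF u] by (simp flip: lookup_edeg)
      then show "bin u (r (edeg A u)) \<in> bins A"
        using u r[OF u] by (intro bin_in_bins) (auto simp: equideg_def)
    qed
    finally show "p \<in> vs.span (bins A)" .
  qed
qed

lemma equideg_add:
  assumes "equideg A u v" "keys w \<subseteq> {..<length A}"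
  shows "equideg A (w + u) (w + v)"
  using assms Poly_Mapping.keys_add[of w u] Poly_Mapping.keys_add[of w v]
  by (auto simp: equideg_def fun_eq_iff tdeg_add)

lemma keys_add_nat: "keys (u + v) = keys u \<union> keys v" for u v :: "nat \<Rightarrow>\<^sub>0 nat"
  by (auto simp: in_keys_iff lookup_add)

lemma monomial_mult_bin: "single w 1 * bin u v = bin (w + u) (w + v)"
  by (simp add: bin_def algebra_simps mult_single)

lemma lin_mult: "lin (\<lambda>p. h * p)"
  by (rule linI) (auto simp: scl_def algebra_simps)

lemma monomial_mult_in_span_sbins:
  fixes p :: "'k::field mpol"
  assumes "p \<in> vs.span (bins A)" "keys w \<subseteq> {..<length A}" "w \<noteq> 0"
  shows "single w 1 * p \<in> vs.span (sbins A)"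
proof (rule lin_span_image_subset[OF lin_mult _ assms(1)])
  obtain i where i: "i \<in> keys w" using assms(3) by fastforce
  have "single w 1 * bin u v \<in> (sbins A :: 'k mpol set)" if "equideg A u v" for u v
    unfolding monomial_mult_bin
    by (rule bin_in_sbins[of _ _ _ i]) (use i that assms in \<open>auto simp: equideg_add keys_add_nat\<close>)
  then show "(*) (single w 1) ` bins A \<subseteq> vs.span (sbins A :: 'k mpol set)"
    by (auto simp: bins_def intro: vs.span_base)
qed

text \<open>The constant term of \<open>h\<close> contributes a scalar multiple of \<open>p\<close>;
  every other monomial of \<open>h\<close> moves \<open>p\<close> into
  \<open>\<mm> I\<^sub>A\<close>.\<close>

lemma mult_in_span_insert_sbins:
  fixes p :: "'k::field mpol"
  assumes p: "p \<in> vs.span (bins A)" and h: "h \<in> polyring (length A)"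
  shows "h * p \<in> vs.span (insert p (sbins A))"
proof -
  have "h * p = ext (\<lambda>u. single u 1) h * p" by (simp add: ext_monomials)
  also have "\<dots> = (\<Sum>u\<in>keys h. scl (lookup h u) (single u 1 * p))"
    by (simp add: ext_def sum_distrib_right scl_def mult.assoc)
  also have "\<dots> \<in> vs.span (insert p (sbins A))"
  proof (intro vs.span_sum vs.span_scale)
    fix u assume "u \<in> keys h"
    then have u: "keys u \<subseteq> {..<length A}" using h by (auto simp: polyring_def)
    show "single u 1 * p \<in> vs.span (insert p (sbins A))"
    proof (cases "u = 0")
      case True then show ?thesis by (simp add: vs.span_base)
    next
      case False
      then show ?thesis
        using monomial_mult_in_span_sbins[OF p u] vs.span_mono[of "sbins A" "insert p (sbins A)"] by blast
    qed
  qed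
  finally show ?thesis .
qed

lemma toric_ideal_mult:
  assumes "p \<in> toric_ideal A" "h \<in> polyring (length A)"
  shows "h * p \<in> toric_ideal A"
proof -
  have "insert p (sbins A) \<subseteq> vs.span (bins A)"
    using assms(1) sbins_subset_bins vs.span_superset unfolding toric_ideal_eq_span_bins by blast
  then have "vs.span (insert p (sbins A)) \<subseteq> vs.span (bins A)"
    by (rule vs.span_minimal) (rule vs.subspace_span)
  then show ?thesis
    using mult_in_span_insert_sbins[of p A h] assms unfolding toric_ideal_eq_span_bins by blast
qed

section \<open>Generated ideals and spanning sets modulo \<open>\<mm> I\<^sub>A\<close>\<close>

lemma gen_ideal_base:
  assumes "finite G" "g \<in> G" shows "g \<in> gen_ideal n G"
  unfolding gen_ideal_def
  by (intro CollectI exI[of _ "\<lambda>x. if x = g then 1 else 0"])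
    (use assms in \<open>simp add: if_distrib[of "\<lambda>x. x * _"] cong: if_cong\<close>)

lemma gen_ideal_mult:
  assumes "p \<in> gen_ideal n G" "q \<in> polyring n" shows "q * p \<in> gen_ideal n G"
proof -
  obtain h where h: "p = (\<Sum>g\<in>G. h g * g)" "\<forall>g\<in>G. h g \<in> polyring n"
    using assms(1) by (auto simp: gen_ideal_def)
  then show ?thesis unfolding gen_ideal_def
    by (intro CollectI exI[of _ "\<lambda>g. q * h g"])
      (use assms(2) polyring_mult in \<open>auto simp: sum_distrib_left mult.assoc\<close>)
qed

lemma subspace_gen_ideal: "vs.subspace (gen_ideal n G)"
  unfolding vs.subspace_def
proof (intro conjI ballI allI)
  show "0 \<in> gen_ideal n G"
    unfolding gen_ideal_def by (intro CollectI exI[of _ "\<lambda>_. 0"]) simp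
  show "scl c p \<in> gen_ideal n G" if "p \<in> gen_ideal n G" for c p
    unfolding scl_def by (rule gen_ideal_mult[OF that]) auto
  show "p + q \<in> gen_ideal n G" if "p \<in> gen_ideal n G" "q \<in> gen_ideal n G" for p q
  proof -
    obtain h h' where "p = (\<Sum>g\<in>G. h g * g)" "\<forall>g\<in>G. h g \<in> polyring n"
      "q = (\<Sum>g\<in>G. h' g * g)" "\<forall>g\<in>G. h' g \<in> polyring n"
      using \<open>p \<in> _\<close> \<open>q \<in> _\<close> by (auto simp: gen_ideal_def)
    then show ?thesis unfolding gen_ideal_def
      by (intro CollectI exI[of _ "\<lambda>g. h g + h' g"])
        (auto simp: sum.distrib algebra_simps polyring_add)
  qed
qed

text \<open>Expresses that the classes of \<open>S\<close> span the vector space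
  \<open>I\<^sub>A / \<mm> I\<^sub>A\<close>, again without forming the quotient.\<close>

definition spans_mod :: "nat list list \<Rightarrow> 'k::field mpol set \<Rightarrow> bool" where
  "spans_mod A S \<longleftrightarrow> finite S \<and> S \<subseteq> vs.span (bins A) \<and> bins A \<subseteq> vs.span (S \<union> sbins A)"

text \<open>The easy half of Nakayama: modulo \<open>\<mm> I\<^sub>A\<close> only the constant terms
  of the coefficients \<open>h g\<close> survive.\<close>

lemma generators_span_mod:
  fixes G :: "'k::field mpol set"
  assumes "finite G" "gen_ideal (length A) G = toric_ideal A"
  shows "spans_mod A G"
proof -
  have G: "G \<subseteq> vs.span (bins A)"
    using gen_ideal_base[OF assms(1)] assms(2) toric_ideal_eq_span_bins by blast
  have "p \<in> vs.span (G \<union> sbins A)" if "p \<in> bins A" for p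
  proof -
    have "p \<in> gen_ideal (length A) G"
      using that assms(2) toric_ideal_eq_span_bins vs.span_base by blast
    then obtain h where h: "p = (\<Sum>g\<in>G. h g * g)" "\<forall>g\<in>G. h g \<in> polyring (length A)"
      by (auto simp: gen_ideal_def)
    have "h g * g \<in> vs.span (G \<union> sbins A)" if "g \<in> G" for g
      using mult_in_span_insert_sbins[of g A "h g"] h(2) G that
        vs.span_mono[of "insert g (sbins A)" "G \<union> sbins A"] by blast
    then show ?thesis unfolding h(1) by (rule vs.span_sum)
  qed
  then show ?thesis using assms(1) G by (auto simp: spans_mod_def)
qed

section \<open>The positive grading and graded Nakayama\<close>

definition wf_vecs :: "nat \<Rightarrow> nat list list \<Rightarrow> bool" where
  "wf_vecs m A \<longleftrightarrow> (\<forall>a\<in>set A. length a = m \<and> a \<noteq> replicate m 0)"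

lemma wf_vecs_pos:
  assumes "wf_vecs m A" "i < length A"
  obtains j where "j < m" "nth_default 0 (A ! i) j > 0"
proof -
  have l: "length (A ! i) = m" and "A ! i \<noteq> replicate m 0"
    using assms by (auto simp: wf_vecs_def)
  then obtain j where "j < m" "A ! i ! j \<noteq> 0"
    by (auto simp: list_eq_iff_nth_eq)
  then show thesis using that[of j] l by (simp add: nth_default_def)
qed

lemma tdeg_single: "i < length A \<Longrightarrow> tdeg A (single i k) j = k * nth_default 0 (A ! i) j"
  by (simp add: tdeg_def lookup_single when_def if_distrib[of "\<lambda>x. x * _"] cong: if_cong)

text \<open>A weight that is positive on every variable, because no vector is zero. Cancelling a
  variable lowers it, which drives the induction in Nakayama's lemma.\<close>

definition total :: "nat \<Rightarrow> nat list list \<Rightarrow> (nat \<Rightarrow>\<^sub>0 nat) \<Rightarrow> nat" where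
  "total m A u = (\<Sum>j<m. tdeg A u j)"

lemma total_add: "total m A (u + v) = total m A u + total m A v"
  by (simp add: total_def tdeg_add sum.distrib)

lemma total_single_pos:
  assumes "wf_vecs m A" "i < length A"
  shows "total m A (single i 1) > 0"
proof -
  obtain j where "j < m" "nth_default 0 (A ! i) j > 0" using wf_vecs_pos[OF assms] .
  then show ?thesis
    unfolding total_def using assms(2)
    by (intro sum_pos2[of _ j]) (auto simp: tdeg_single)
qed

lemma split_off_var:
  fixes u :: "nat \<Rightarrow>\<^sub>0 nat"
  assumes "i \<in> keys u" shows "u = single i 1 + (u - single i 1)"
  using assms by (intro poly_mapping_eqI) (auto simp: lookup_add lookup_minus lookup_single when_def in_keys_iff)

lemma equideg_cancel:
  assumes "equideg A (w + u) (w + v)" shows "equideg A u v"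
  using assms by (auto simp: equideg_def fun_eq_iff tdeg_add keys_add_nat)

text \<open>Graded Nakayama: a binomial of degree \<open>d\<close> is congruent to a combination of \<open>T\<close> modulo
  multiples of binomials of smaller degree, after projecting to degree \<open>d\<close>.\<close>

lemma homogeneous_span_mod_generates:
  fixes T :: "'k::field mpol set"
  assumes wf: "wf_vecs m A" and T: "finite T" "T \<subseteq> bins A" "bins A \<subseteq> vs.span (T \<union> sbins A)"
  shows "gen_ideal (length A) T = toric_ideal A"
proof
  let ?n = "length A" and ?J = "gen_ideal (length A) T"
  have "equideg A u v \<Longrightarrow> bin u v \<in> ?J" for u v
  proof (induction "total m A u" arbitrary: u v rule: less_induct)
    case less
    \<comment> \<open>The combination representing \<open>bin u v\<close> may involve binomials of
      other degrees, to which the induction hypothesis need not apply; \<open>P\<close> discards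
      them.\<close>
    define P :: "'k mpol \<Rightarrow> 'k mpol" where
      "P = ext (\<lambda>w. if tdeg A w = tdeg A u then single w 1 else 0)"
    have P_bin: "P (bin u' v') = (if tdeg A u' = tdeg A u then bin u' v' else 0)"
      if "equideg A u' v'" for u' v'
      using that by (auto simp: P_def ext_bin equideg_def) (simp add: bin_def)
    \<comment> \<open>A member of \<open>T\<close> is homogeneous, so \<open>P\<close> keeps or
      kills it. A binomial in the degree of \<open>u\<close> with a common variable is that variable
      times a binomial of smaller weight, which the induction hypothesis covers.\<close>
    have "P (bin u' v') \<in> ?J" if e: "equideg A u' v'" and d: "bin u' v' \<in> T \<or> keys u' \<inter> keys v' \<noteq> {}" for u' v'
    proof (cases "tdeg A u' = tdeg A u \<and> bin u' v' \<notin> T")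
      case False
      then show ?thesis
        using P_bin[OF e] gen_ideal_base[OF T(1)] vs.subspace_0[OF subspace_gen_ideal] by auto
    next
      case True
      then obtain i where i: "i \<in> keys u'" "i \<in> keys v'" using d by blast
      then have "i < ?n" using e by (auto simp: equideg_def)
      define u'' v'' where "u'' = u' - single i 1" "v'' = v' - single i 1"
      have s: "u' = single i 1 + u''" "v' = single i 1 + v''"
        unfolding u''_v''_def using i split_off_var by auto
      then have e': "equideg A u'' v''" using e equideg_cancel by metis
      have "total m A u'' < total m A u'"
        using total_add[of m A "single i 1" u''] total_single_pos[OF wf \<open>i < ?n\<close>] s(1) by auto
      also have "total m A u' = total m A u" using True by (simp add: total_def)
      finally have "bin u'' v'' \<in> ?J" using less.hyps e' by blast
      then have "single (single i 1) 1 * bin u'' v'' \<in> ?J"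
        by (rule gen_ideal_mult) (use \<open>i < ?n\<close> in auto)
      then show ?thesis using P_bin[OF e] True s by (simp add: monomial_mult_bin)
    qed
    then have "P ` (T \<union> sbins A) \<subseteq> ?J"
      using T(2) by (auto simp: sbins_def bins_def)
    moreover have "lin P" unfolding P_def by (rule lin_ext)
    moreover have "bin u v \<in> vs.span (T \<union> sbins A)"
      using T(3) less.prems by (auto simp: bin_in_bins)
    ultimately have "P (bin u v) \<in> ?J"
      using lin_span_image_subspace subspace_gen_ideal by blast
    then show ?case using P_bin[OF less.prems] by simp
  qed
  then have "bins A \<subseteq> ?J" by (auto simp: bins_def)
  then show "toric_ideal A \<subseteq> ?J"
    unfolding toric_ideal_eq_span_bins by (rule vs.span_minimal[OF _ subspace_gen_ideal])
  show "?J \<subseteq> toric_ideal A"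
  proof
    fix p assume "p \<in> ?J"
    then obtain h where h: "p = (\<Sum>g\<in>T. h g * g)" "\<forall>g\<in>T. h g \<in> polyring ?n"
      by (auto simp: gen_ideal_def)
    show "p \<in> toric_ideal A"
      unfolding h(1) using h(2) T(2) vs.span_base toric_ideal_eq_span_bins
      by (intro vs.subspace_sum[OF subspace_toric_ideal] toric_ideal_mult) blast+
  qed
qed

text \<open>The graded argument works with binomials, while \<open>S\<close> may contain arbitrary
  polynomials of the ideal. The exchange lemma first trades \<open>S\<close> for at most as many
  binomials.\<close>

lemma span_mod_imp_generators:
  fixes S :: "'k::field mpol set"
  assumes "wf_vecs m A" "spans_mod A S"
  obtains G :: "'k mpol set" where "finite G" "G \<subseteq> polyring (length A)" "card G \<le> card S"
    "gen_ideal (length A) G = toric_ideal A"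
proof -
  have S: "finite S" "bins A \<subseteq> vs.span (S \<union> sbins A)" using assms(2) by (auto simp: spans_mod_def)
  obtain T :: "'k mpol set" where T: "T \<subseteq> bins A" "finite T" "card T \<le> card S" "bins A \<subseteq> vs.span (T \<union> sbins A)"
    using exchange_mod_subspace[OF S] by metis
  moreover have "T \<subseteq> polyring (length A)"
    using T(1) bin_in_polyring by (auto simp: bins_def)
  ultimately show thesis
    using that homogeneous_span_mod_generates[OF assms(1) T(2,1,4)] by blast
qed

section \<open>The minimal number of generators\<close>

lemma nat_incseq_subseq:
  fixes f :: "nat \<Rightarrow> nat"
  obtains r where "strict_mono r" "incseq (f \<circ> r)"
proof -
  obtain r where r: "strict_mono r" "monoseq (\<lambda>n. f (r n))" using seq_monosub by blast
  show thesis
  proof (cases "incseq (\<lambda>n. f (r n))")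
    case True
    then show thesis using that r by (simp add: comp_def)
  next
    case False
    then have d: "decseq (\<lambda>n. f (r n))" using r(2) by (simp add: monoseq_iff)
    \<comment> \<open>A decreasing sequence of naturals attains its minimum and stays constant from
      there on, so its tail is weakly increasing.\<close>
    define k where "k = (LEAST k. \<exists>n. f (r n) = k)"
    have "\<exists>n. f (r n) = k" unfolding k_def by (rule LeastI_ex) blast
    then obtain N where N: "f (r N) = k" by blast
    have const: "f (r (N + i)) = k" for i
    proof (rule antisym)
      show "f (r (N + i)) \<le> k" using d N by (metis decseqD le_add1)
      show "k \<le> f (r (N + i))" unfolding k_def by (rule Least_le) blast
    qed
    have "strict_mono (\<lambda>i. r (N + i))" using r(1) by (simp add: strict_mono_def)
    moreover have "incseq (f \<circ> (\<lambda>i. r (N + i)))" by (simp add: const incseq_def)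
    ultimately show thesis by (rule that)
  qed
qed

text \<open>The coordinates are treated one after another, each time passing to a further
  subsequence; monotonicity of the earlier coordinates survives.\<close>

lemma dickson_subseq:
  fixes f :: "nat \<Rightarrow> nat \<Rightarrow> nat"
  shows "\<exists>r. strict_mono r \<and> (\<forall>i<n. incseq (\<lambda>k. f (r k) i))"
proof (induction n)
  case 0
  have "strict_mono (id :: nat \<Rightarrow> nat)" by (simp add: strict_mono_def)
  then show ?case by blast
next
  case (Suc n)
  then obtain r where r: "strict_mono r" "\<forall>i<n. incseq (\<lambda>k. f (r k) i)" by blast
  obtain s where s: "strict_mono s" "incseq ((\<lambda>k. f (r k) n) \<circ> s)"
    using nat_incseq_subseq by blast
  have "strict_mono (r \<circ> s)" using r(1) s(1) by (rule strict_mono_o)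
  moreover have "incseq (\<lambda>k. f ((r \<circ> s) k) i)" if "i < Suc n" for i
  proof (cases "i = n")
    case True
    then show ?thesis using s(2) by (simp add: comp_def)
  next
    case False
    then have "incseq (\<lambda>k. f (r k) i)" using r(2) that by simp
    then show ?thesis using strict_mono_mono[OF s(1)] by (simp add: incseq_def mono_def)
  qed
  ultimately show ?case by blast
qed

lemma finite_antichain:
  fixes X :: "'a set" and f :: "'a \<Rightarrow> nat \<Rightarrow> nat"
  assumes "\<And>x y. x \<in> X \<Longrightarrow> y \<in> X \<Longrightarrow> (\<And>i. i < n \<Longrightarrow> f x i \<le> f y i) \<Longrightarrow> x = y"
  shows "finite X"
proof (rule ccontr)
  assume "infinite X"
  then obtain g :: "nat \<Rightarrow> 'a" where g: "inj g" "range g \<subseteq> X"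
    using infinite_countable_subset by blast
  obtain r where r: "strict_mono r" "\<forall>i<n. incseq (\<lambda>k. f (g (r k)) i)"
    using dickson_subseq[of n "f \<circ> g"] by auto
  have "g (r 0) = g (r 1)"
    using r(2) g(2) by (intro assms) (auto simp: incseq_def)
  then have "r 0 = r 1" using g(1) by (simp add: inj_eq)
  then show False using r(1) by (metis strict_mono_eq zero_neq_one)
qed

lemma equideg_zero:
  assumes "wf_vecs m A" "equideg A u 0" shows "u = 0"
proof (rule ccontr)
  assume "u \<noteq> 0"
  then obtain i where i: "i \<in> keys u" by fastforce
  have "total m A (single i 1) > 0"
    using assms(2) i by (intro total_single_pos[OF assms(1)]) (auto simp: equideg_def)
  then have "total m A u > 0"
    using split_off_var[OF i] total_add[of m A "single i 1" "u - single i 1"] by simp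
  then show False using assms(2) by (simp add: total_def equideg_def)
qed

lemma equideg_sym: "equideg A u v \<Longrightarrow> equideg A v u"
  by (auto simp: equideg_def)

text \<open>The minimal nonzero pairs of monomials of equal degree are finitely many by Dickson's
  lemma. Any other pair splits as a sum of two such nonzero pairs, which places its binomial in
  \<open>\<mm> I\<^sub>A\<close>. This secures that the minimum defining \<open>mu\<close> is
  attained.\<close>

lemma spans_mod_exists:
  assumes wf: "wf_vecs m A"
  shows "\<exists>S :: 'k::field mpol set. spans_mod A S"
proof -
  let ?n = "length A"
  define D where "D = {(u, v). equideg A u v \<and> (u, v) \<noteq> (0, 0)}"
  define below :: "_ \<Rightarrow> _ \<Rightarrow> bool" where
    "below p q \<longleftrightarrow> (\<forall>i. lookup (fst p) i \<le> lookup (fst q) i \<and> lookup (snd p) i \<le> lookup (snd q) i)"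
    for p q :: "(nat \<Rightarrow>\<^sub>0 nat) \<times> (nat \<Rightarrow>\<^sub>0 nat)"
  define M where "M = {q \<in> D. \<forall>p\<in>D. below p q \<longrightarrow> p = q}"
  have "finite M"
  \<comment> \<open>A pair of monomials is read as one tuple of \<open>2 * ?n\<close> exponents,
    first those of \<open>u\<close>, then those of \<open>v\<close>.\<close>
  proof (rule finite_antichain)
    fix p q assume pq: "p \<in> M" "q \<in> M"
      and le: "\<And>i. i < 2 * ?n \<Longrightarrow> (if i < ?n then lookup (fst p) i else lookup (snd p) (i - ?n))
        \<le> (if i < ?n then lookup (fst q) i else lookup (snd q) (i - ?n))"
    have z: "lookup (fst p) i = 0" "lookup (snd p) i = 0" if "\<not> i < ?n" for i
      using pq(1) that by (auto simp: M_def D_def equideg_def in_keys_iff subset_iff)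
    have "below p q" unfolding below_def
    proof (intro allI conjI)
      fix i
      show "lookup (fst p) i \<le> lookup (fst q) i" using le[of i] z(1)[of i] by (cases "i < ?n") auto
      show "lookup (snd p) i \<le> lookup (snd q) i" using le[of "?n + i"] z(2)[of i] by (cases "i < ?n") auto
    qed
    then show "p = q" using pq by (auto simp: M_def)
  qed
  define S :: "'k mpol set" where "S = (\<lambda>(u, v). bin u v) ` M"
  have "bin u v \<in> vs.span (S \<union> sbins A)" if e: "equideg A u v" for u v
  proof (cases "(u, v) \<in> M \<or> (u, v) = (0, 0)")
    case True
    then show ?thesis by (auto simp: S_def vs.span_zero intro: vs.span_base)
  next
    case False
    then have "(u, v) \<in> D - M" using e by (auto simp: D_def)
    then obtain u' v' where p: "(u', v') \<in> D" "below (u', v') (u, v)" "(u', v') \<noteq> (u, v)"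
      by (auto simp: M_def)
    define u'' v'' where "u'' = u - u'" "v'' = v - v'"
    have s: "u = u' + u''" "v = v' + v''"
      using p(2) unfolding u''_v''_def
      by (auto intro!: poly_mapping_eqI simp: below_def lookup_add lookup_minus)
    have ks: "keys u = keys u' \<union> keys u''" "keys v = keys v' \<union> keys v''"
      using s keys_add_nat by auto
    have e': "equideg A u' v'" using p(1) by (auto simp: D_def)
    then have e'': "equideg A u'' v''"
      using e ks s by (auto simp: equideg_def fun_eq_iff tdeg_add)
    \<comment> \<open>Telescoping through the monomial \<open>u'' + v'\<close>. Both multipliers are
      nontrivial: \<open>u'' = 0\<close> would force \<open>v'' = 0\<close> and make the two pairs
      equal, and \<open>v' = 0\<close> would force \<open>u' = 0\<close>, which \<open>D\<close>
      excludes.\<close>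
    have "(bin u v :: 'k mpol) = single u'' 1 * bin u' v' + single v' 1 * bin u'' v''"
      by (simp add: monomial_mult_bin s) (simp add: bin_def algebra_simps)
    moreover have "u'' \<noteq> 0"
      using equideg_zero[OF wf equideg_sym, of v''] e'' p(3) s by auto
    moreover have "v' \<noteq> 0"
      using equideg_zero[OF wf, of u'] e' p(1) by (auto simp: D_def)
    moreover have "(bin u' v' :: 'k mpol) \<in> vs.span (bins A)" "(bin u'' v'' :: 'k mpol) \<in> vs.span (bins A)"
      using e' e'' bin_in_bins vs.span_base by blast+
    moreover have "keys u'' \<subseteq> {..<?n}" "keys v' \<subseteq> {..<?n}"
      using e' e'' by (auto simp: equideg_def)
    ultimately have "(bin u v :: 'k mpol) \<in> vs.span (sbins A)"
      by (simp add: vs.span_add monomial_mult_in_span_sbins)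
    then show ?thesis using vs.span_mono[of "sbins A" "S \<union> sbins A"] by blast
  qed
  moreover have "finite S" using \<open>finite M\<close> by (simp add: S_def)
  moreover have "S \<subseteq> vs.span (bins A)"
    by (auto simp: S_def M_def D_def intro!: vs.span_base bin_in_bins)
  ultimately have "spans_mod A S"
    by (auto simp: spans_mod_def bins_def)
  then show ?thesis by blast
qed

section \<open>The dimension of \<open>I\<^sub>A / \<mm> I\<^sub>A\<close> and its comparison along
  linear maps\<close>

definition mu :: "'k::field itself \<Rightarrow> nat list list \<Rightarrow> nat" where
  "mu _ A = (LEAST c. \<exists>S :: 'k mpol set. spans_mod A S \<and> card S = c)"

lemma mu_le: "spans_mod A S \<Longrightarrow> mu TYPE('k) A \<le> card S" for S :: "'k::field mpol set"
  unfolding mu_def by (rule Least_le) blast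

lemma mu_attained:
  assumes "wf_vecs m A"
  obtains S :: "'k::field mpol set" where "spans_mod A S" "card S = mu TYPE('k) A"
proof -
  have "\<exists>c. \<exists>S :: 'k mpol set. spans_mod A S \<and> card S = c"
    using spans_mod_exists[OF assms] by blast
  from LeastI_ex[OF this] show thesis using that unfolding mu_def by blast
qed

text \<open>Both halves of Nakayama: generators span modulo \<open>\<mm> I\<^sub>A\<close>, and a
  smallest spanning set yields a generating set that is no larger.\<close>

lemma min_gens_eq_mu:
  assumes "wf_vecs m A"
  shows "min_gens (length A) (toric_ideal A :: 'k::field mpol set) = mu TYPE('k) A"
proof -
  let ?I = "toric_ideal A :: 'k mpol set"
  obtain S :: "'k mpol set" where S: "spans_mod A S" "card S = mu TYPE('k) A"
    using mu_attained[OF assms] .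
  obtain G :: "'k mpol set" where G: "finite G" "G \<subseteq> polyring (length A)" "card G \<le> card S"
    "gen_ideal (length A) G = ?I"
    using span_mod_imp_generators[OF assms S(1)] .
  show ?thesis unfolding min_gens_def
  proof (rule Least_equality)
    have "mu TYPE('k) A \<le> card G" using mu_le[OF generators_span_mod[OF G(1,4)]] .
    then have "card G = mu TYPE('k) A" using G(3) S(2) by simp
    then show "\<exists>G. finite G \<and> G \<subseteq> polyring (length A) \<and> card G = mu TYPE('k) A \<and> gen_ideal (length A) G = ?I"
      using G by blast
  next
    fix c assume "\<exists>G. finite G \<and> G \<subseteq> polyring (length A) \<and> card G = c \<and> gen_ideal (length A) G = ?I"
    then show "mu TYPE('k) A \<le> c" using mu_le generators_span_mod by blast
  qed
qed

text \<open>The hypotheses on \<open>L\<close> say that it induces a linear map between the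
  quotients; \<open>E\<close> makes up for its failure to be surjective.\<close>

lemma spans_mod_image:
  fixes L :: "'k::field mpol \<Rightarrow> 'k mpol"
  assumes L: "lin L" "L ` bins A \<subseteq> vs.span (bins A')" "L ` sbins A \<subseteq> vs.span (sbins A')"
    and E: "finite E" "E \<subseteq> vs.span (bins A')" "bins A' \<subseteq> vs.span (L ` bins A \<union> E \<union> sbins A')"
    and S: "spans_mod A S"
  shows "spans_mod A' (L ` S \<union> E)"
proof -
  let ?V = "vs.span (L ` S \<union> E \<union> sbins A')"
  have S': "finite S" "S \<subseteq> vs.span (bins A)" "bins A \<subseteq> vs.span (S \<union> sbins A)"
    using S by (auto simp: spans_mod_def)
  have "L ` sbins A \<subseteq> ?V" using L(3) vs.span_mono[of "sbins A'" "L ` S \<union> E \<union> sbins A'"] by blast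
  moreover have "L ` S \<subseteq> ?V" "E \<subseteq> ?V" "sbins A' \<subseteq> ?V"
    by (auto intro: vs.span_base)
  ultimately have "L ` (S \<union> sbins A) \<subseteq> ?V" by blast
  then have "L ` bins A \<subseteq> ?V"
    using lin_span_image_subset[OF L(1)] S'(3) by blast
  then have "L ` bins A \<union> E \<union> sbins A' \<subseteq> ?V"
    using \<open>E \<subseteq> ?V\<close> \<open>sbins A' \<subseteq> ?V\<close> by blast
  then have "bins A' \<subseteq> ?V"
    using E(3) vs.span_minimal[OF _ vs.subspace_span] by blast
  moreover have "L ` S \<subseteq> vs.span (bins A')"
    using lin_span_image_subset[OF L(1,2)] S'(2) by blast
  ultimately show ?thesis using S'(1) E(1,2) by (auto simp: spans_mod_def)
qed

lemma mu_le_of_lin: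
  fixes L :: "'k::field mpol \<Rightarrow> 'k mpol"
  assumes "wf_vecs m A" "lin L" "L ` bins A \<subseteq> vs.span (bins A')" "L ` sbins A \<subseteq> vs.span (sbins A')"
    and "finite E" "E \<subseteq> vs.span (bins A')" "bins A' \<subseteq> vs.span (L ` bins A \<union> E \<union> sbins A')"
  shows "mu TYPE('k) A' \<le> mu TYPE('k) A + card E"
proof -
  obtain S :: "'k mpol set" where S: "spans_mod A S" "card S = mu TYPE('k) A"
    using mu_attained[OF assms(1)] .
  have "mu TYPE('k) A' \<le> card (L ` S \<union> E)"
    by (rule mu_le[OF spans_mod_image[OF assms(2-) S(1)]])
  also have "\<dots> \<le> card (L ` S) + card E" by (rule card_Un_le)
  also have "card (L ` S) \<le> card S"
    using S(1) by (intro card_image_le) (simp add: spans_mod_def)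
  finally show ?thesis using S(2) by simp
qed

text \<open>Surjectivity on the quotients has to be checked only on binomials with disjoint
  supports, since all others vanish there. Values of \<open>f\<close> may be 0, so a map can discard
  monomials.\<close>

lemma mu_le_of_monomial_map:
  fixes f :: "(nat \<Rightarrow>\<^sub>0 nat) \<Rightarrow> 'k::field mpol"
  assumes "wf_vecs m A"
    and "\<And>u v. equideg A u v \<Longrightarrow> f u - f v \<in> insert 0 (bins A')"
    and "\<And>u v i. equideg A u v \<Longrightarrow> i \<in> keys u \<Longrightarrow> i \<in> keys v \<Longrightarrow> f u - f v \<in> insert 0 (sbins A')"
    and "\<And>u v. equideg A' u v \<Longrightarrow> keys u \<inter> keys v = {} \<Longrightarrow>
           \<exists>u' v'. equideg A u' v' \<and> f u' = single u 1 \<and> f v' = single v 1"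
  shows "mu TYPE('k) A' \<le> mu TYPE('k) A"
proof -
  have "mu TYPE('k) A' \<le> mu TYPE('k) A + card ({} :: 'k mpol set)"
  proof (rule mu_le_of_lin[OF assms(1) lin_ext])
    have "ext f ` bins A \<subseteq> insert 0 (bins A')"
      using assms(2) by (fastforce simp: bins_def[of A] ext_bin)
    then show "ext f ` bins A \<subseteq> vs.span (bins A')"
      using vs.span_superset[of "insert 0 (bins A')"] by (auto simp only: vs.span_insert_0)
    have "ext f ` sbins A \<subseteq> insert 0 (sbins A')"
      using assms(3) by (fastforce simp: sbins_def[of A] ext_bin)
    then show "ext f ` sbins A \<subseteq> vs.span (sbins A')"
      using vs.span_superset[of "insert 0 (sbins A')"] by (auto simp only: vs.span_insert_0)
    have "bin u v \<in> ext f ` bins A \<union> {} \<union> sbins A'" if e: "equideg A' u v" for u v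
    proof (cases "keys u \<inter> keys v = {}")
      case True
      then obtain u' v' where "equideg A u' v'" "f u' = single u 1" "f v' = single v 1"
        using assms(4) e by blast
      then have "bin u v = ext f (bin u' v')" "bin u' v' \<in> (bins A :: 'k mpol set)"
        by (simp_all add: ext_bin bin_in_bins) (simp add: bin_def)
      then show ?thesis by blast
    qed (use e bin_in_sbins in blast)
    then have "bins A' \<subseteq> ext f ` bins A \<union> {} \<union> sbins A'"
      unfolding bins_def[of A'] by blast
    then show "bins A' \<subseteq> vs.span (ext f ` bins A \<union> {} \<union> sbins A')"
      using vs.span_superset by (rule order_trans)
  qed auto
  then show ?thesis by simp
qed

section \<open>Appending a vector\<close>

lemma wf_vecs_append [simp]: "wf_vecs m (A @ [a]) \<longleftrightarrow> wf_vecs m A \<and> length a = m \<and> a \<noteq> replicate m 0"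
  by (auto simp: wf_vecs_def)

lemma wf_vecs_mset_cong: "mset A = mset A' \<Longrightarrow> wf_vecs m A \<longleftrightarrow> wf_vecs m A'"
  by (simp add: wf_vecs_def flip: set_mset_mset)

lemma monomial_diff_in_bins: "equideg A u v \<Longrightarrow> single u 1 - single v 1 \<in> insert 0 (bins A)"
  using bin_in_bins by (auto simp: bin_def)

lemma monomial_diff_in_sbins:
  "equideg A u v \<Longrightarrow> i \<in> keys u \<Longrightarrow> i \<in> keys v \<Longrightarrow> single u 1 - single v 1 \<in> insert 0 (sbins A)"
  using bin_in_sbins by (auto simp: bin_def)

text \<open>Reordering the list only renames variables, a bijection of monomials that respects
  degrees and common variables.\<close>

lemma mu_mset_le:
  assumes wf: "wf_vecs m A" and eq: "mset A' = mset A"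
  shows "mu TYPE('k::field) A' \<le> mu TYPE('k) A"
proof -
  let ?n = "length A"
  have len: "length A' = ?n" using mset_eq_length[OF eq] .
  obtain p where p: "p permutes {..<?n}" "permute_list p A = A'"
    using mset_eq_permutation[OF eq] .
  have nth: "A' ! i = A ! p i" if "i < ?n" for i
    using permute_list_nth[OF p(1) that] p(2) by simp
  have ip: "inj p" "inj (inv p)" using p(1) permutes_inj permutes_inv by blast+
  \<comment> \<open>Since \<open>A' ! i = A ! p i\<close>, the variable with index
    \<open>p i\<close> is renamed to the one with index \<open>i\<close>.\<close>
  define \<sigma> :: "(nat \<Rightarrow>\<^sub>0 nat) \<Rightarrow> (nat \<Rightarrow>\<^sub>0 nat)" where "\<sigma> = Poly_Mapping.map_key p"
  have lk: "lookup (\<sigma> u) i = lookup u (p i)" for u i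
    unfolding \<sigma>_def using ip(1) by (simp add: Poly_Mapping.map_key.rep_eq)
  have ks: "i \<in> keys (\<sigma> u) \<longleftrightarrow> p i \<in> keys u" for u i
    by (simp add: in_keys_iff lk)
  have td: "tdeg A' (\<sigma> u) = tdeg A u" for u
  proof
    fix j
    have "tdeg A' (\<sigma> u) j = (\<Sum>i<?n. lookup u (p i) * nth_default 0 (A ! p i) j)"
      unfolding tdeg_def len by (intro sum.cong) (auto simp: lk nth)
    also have "\<dots> = tdeg A u j"
      unfolding tdeg_def using sum.permute[OF p(1), of "\<lambda>i. lookup u i * nth_default 0 (A ! i) j"]
      by (simp add: comp_def)
    finally show "tdeg A' (\<sigma> u) j = tdeg A u j" .
  qed
  have pin: "p i < ?n \<longleftrightarrow> i < ?n" for i using permutes_in_image[OF p(1), of i] by simp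
  have ksub: "keys (\<sigma> u) \<subseteq> {..<?n} \<longleftrightarrow> keys u \<subseteq> {..<?n}" for u
  proof
    assume *: "keys u \<subseteq> {..<?n}" show "keys (\<sigma> u) \<subseteq> {..<?n}" using * ks pin by blast
  next
    assume *: "keys (\<sigma> u) \<subseteq> {..<?n}"
    show "keys u \<subseteq> {..<?n}"
    proof
      fix i assume "i \<in> keys u"
      then have "inv p i \<in> keys (\<sigma> u)" using ks permutes_inverses(1)[OF p(1)] by simp
      then show "i \<in> {..<?n}" using * pin[of "inv p i"] permutes_inverses(1)[OF p(1)] by auto
    qed
  qed
  have eqd: "equideg A' (\<sigma> u) (\<sigma> v) \<longleftrightarrow> equideg A u v" for u v
    by (simp add: equideg_def ksub td len)
  have surj: "\<exists>u'. \<sigma> u' = u" for u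
  proof
    show "\<sigma> (Poly_Mapping.map_key (inv p) u) = u"
      using ip permutes_inverses(2)[OF p(1)]
      by (intro poly_mapping_eqI) (simp add: lk Poly_Mapping.map_key.rep_eq)
  qed
  show ?thesis
  proof (rule mu_le_of_monomial_map[OF wf, of "\<lambda>u. single (\<sigma> u) 1"])
    fix u v assume e: "equideg A u v"
    then show "single (\<sigma> u) (1::'k) - single (\<sigma> v) 1 \<in> insert 0 (bins A')"
      by (intro monomial_diff_in_bins) (simp add: eqd)
    fix i assume i: "i \<in> keys u" "i \<in> keys v"
    have "inv p i \<in> keys (\<sigma> u)" "inv p i \<in> keys (\<sigma> v)"
      using i ks permutes_inverses(1)[OF p(1)] by auto
    then show "single (\<sigma> u) (1::'k) - single (\<sigma> v) 1 \<in> insert 0 (sbins A')"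
      using e by (intro monomial_diff_in_sbins) (simp_all add: eqd)
  next
    fix u v assume e: "equideg A' u v"
    obtain u' v' where "\<sigma> u' = u" "\<sigma> v' = v" using surj by metis
    then show "\<exists>u' v'. equideg A u' v' \<and> single (\<sigma> u') 1 = single u (1::'k) \<and> single (\<sigma> v') 1 = single v (1::'k)"
      using e eqd by blast
  qed
qed

lemma mu_mset_cong:
  assumes "wf_vecs m A" "mset A' = mset A"
  shows "mu TYPE('k::field) A' = mu TYPE('k) A"
  using assms wf_vecs_mset_cong[OF assms(2), of m] by (intro antisym mu_mset_le[of m]) simp_all

lemma tdeg_append: "tdeg (A @ [a]) u j = tdeg A u j + lookup u (length A) * nth_default 0 a j"
  by (simp add: tdeg_def nth_append)

abbreviation upd :: "nat \<Rightarrow> nat \<Rightarrow> (nat \<Rightarrow>\<^sub>0 nat) \<Rightarrow> (nat \<Rightarrow>\<^sub>0 nat)" where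
  "upd \<equiv> Poly_Mapping.update"

lemma tdeg_update [simp]: "tdeg A (upd (length A) k u) j = tdeg A u j"
  unfolding tdeg_def by (intro sum.cong) (auto simp: lookup_update)

lemma update_id: "k = lookup u n \<Longrightarrow> upd n k u = u"
  by (intro poly_mapping_eqI) (auto simp: lookup_update)

lemma update_update [simp]: "upd n k (upd n l u) = upd n k u"
  by (intro poly_mapping_eqI) (auto simp: lookup_update)

lemma lookup_update_same [simp]: "lookup (upd n k u) n = k"
  by (simp add: lookup_update)

lemma equideg_append_iff:
  assumes "lookup u (length A) = 0" "lookup v (length A) = 0"
  shows "equideg (A @ [a]) u v \<longleftrightarrow> equideg A u v"
proof -
  have "keys w \<subseteq> {..<Suc (length A)} \<longleftrightarrow> keys w \<subseteq> {..<length A}" if "lookup w (length A) = 0" for w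
    using that by (auto simp: less_Suc_eq in_keys_iff subset_iff)
  then show ?thesis using assms by (auto simp: equideg_def fun_eq_iff tdeg_append)
qed

lemma equideg_lookup_zero: "equideg A u v \<Longrightarrow> lookup u (length A) = 0 \<and> lookup v (length A) = 0"
  by (auto simp: equideg_def in_keys_iff subset_iff)

text \<open>By \<open>free\<close>, a binomial that contains the new variable contains it in both
  monomials and so vanishes modulo \<open>\<mm>\<close> times the ideal. Only the binomials of
  \<open>A\<close> contribute.\<close>

lemma mu_append_free:
  assumes wf: "wf_vecs m (A @ [a])"
    and free: "\<And>u v. equideg (A @ [a]) u v \<Longrightarrow> lookup u (length A) = lookup v (length A)"
  shows "mu TYPE('k::field) (A @ [a]) = mu TYPE('k) A"
proof (rule antisym)
  let ?n = "length A"
  have up: "equideg A u v \<Longrightarrow> equideg (A @ [a]) u v" for u v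
    using equideg_lookup_zero equideg_append_iff by blast
  show "mu TYPE('k) (A @ [a]) \<le> mu TYPE('k) A"
  proof (rule mu_le_of_monomial_map[of m _ "\<lambda>u. single u 1"])
    show "wf_vecs m A" using wf by simp
    fix u v assume e: "equideg A u v"
    then show "single u (1::'k) - single v 1 \<in> insert 0 (bins (A @ [a]))"
      by (intro monomial_diff_in_bins up)
    fix i assume "i \<in> keys u" "i \<in> keys v"
    then show "single u (1::'k) - single v 1 \<in> insert 0 (sbins (A @ [a]))"
      by (rule monomial_diff_in_sbins[OF up[OF e]])
  next
    fix u v assume e: "equideg (A @ [a]) u v" "keys u \<inter> keys v = {}"
    then have "?n \<notin> keys u \<or> ?n \<notin> keys v" by blast
    then have "lookup u ?n = 0" "lookup v ?n = 0"
      using free[OF e(1)] by (auto simp: in_keys_iff)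
    then show "\<exists>u' v'. equideg A u' v' \<and> single u' 1 = single u (1::'k) \<and> single v' 1 = single v (1::'k)"
      using e equideg_append_iff by blast
  qed
  \<comment> \<open>Monomials divisible by the new variable are sent to 0; by \<open>free\<close>
    the two monomials of a binomial survive or vanish together.\<close>
  show "mu TYPE('k) A \<le> mu TYPE('k) (A @ [a])"
  proof (rule mu_le_of_monomial_map[OF wf, of "\<lambda>u. if lookup u ?n = 0 then single u 1 else 0"])
    fix u v assume e: "equideg (A @ [a]) u v"
    have *: "lookup v ?n = lookup u ?n" using free[OF e] by simp
    show "(if lookup u ?n = 0 then single u (1::'k) else 0) - (if lookup v ?n = 0 then single v 1 else 0)
      \<in> insert 0 (bins A)"
      using e * equideg_append_iff[of u A v a] monomial_diff_in_bins[of A u v, where ?'a = 'k] by auto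
    fix i assume i: "i \<in> keys u" "i \<in> keys v"
    show "(if lookup u ?n = 0 then single u (1::'k) else 0) - (if lookup v ?n = 0 then single v 1 else 0)
      \<in> insert 0 (sbins A)"
      using e * i equideg_append_iff[of u A v a] monomial_diff_in_sbins[of A u v i, where ?'a = 'k] by auto
  next
    fix u v assume e: "equideg A u v"
    then have "lookup u ?n = 0" "lookup v ?n = 0" using equideg_lookup_zero by blast+
    then show "\<exists>u' v'. equideg (A @ [a]) u' v' \<and> (if lookup u' ?n = 0 then single u' 1 else 0) = single u (1::'k)
      \<and> (if lookup v' ?n = 0 then single v' 1 else 0) = single v (1::'k)"
      using up[OF e] by (intro exI[of _ u] exI[of _ v]) simp
  qed
qed

lemma nth_default_scaleN: "nth_default 0 (scaleN B a) j = B * nth_default 0 a j"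
  by (simp add: nth_default_def scaleN_def)

lemma keys_update_subset: "keys u \<subseteq> {..<Suc n} \<Longrightarrow> keys (upd n k u) \<subseteq> {..<Suc n}"
  by (auto simp: keys_update)

lemma wf_vecs_scaleN:
  assumes "wf_vecs m (A @ [a])" "B > 0" shows "wf_vecs m (A @ [scaleN B a])"
  using assms by (auto simp: scaleN_def list_eq_iff_nth_eq)

text \<open>The map \<open>up\<close> is the substitution of the \<open>B\<close>-th power of the
  last variable for that variable. It multiplies the last exponent by \<open>B\<close>, which turns
  degrees for \<open>scaleN B a\<close> into degrees for \<open>a\<close>, and \<open>dn\<close>
  inverts it on exponents divisible by \<open>B\<close>.\<close>

lemma mu_append_scale:
  assumes wf: "wf_vecs m (A @ [a])" and B: "B > 0"
    and cong: "\<And>u v. equideg (A @ [a]) u v \<Longrightarrow> lookup u (length A) mod B = lookup v (length A) mod B"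
  shows "mu TYPE('k::field) (A @ [scaleN B a]) = mu TYPE('k) (A @ [a])"
proof (rule antisym)
  let ?n = "length A" and ?A = "A @ [a]" and ?A' = "A @ [scaleN B a]"
  have wf': "wf_vecs m ?A'" using wf B by (rule wf_vecs_scaleN)
  define up where "up u = upd ?n (B * lookup u ?n) u" for u
  define dn where "dn u = upd ?n (lookup u ?n div B) u" for u
  have dn_up: "dn (up u) = u" for u using B by (simp add: up_def dn_def update_id)
  have up_dn: "up (dn u) = u" if "B dvd lookup u ?n" for u
    using that by (simp add: up_def dn_def update_id)
  have eq_up: "equideg ?A (up u) (up v)" if "equideg ?A' u v" for u v
    using that keys_update_subset unfolding equideg_def up_def
    by (auto simp: fun_eq_iff tdeg_append nth_default_scaleN algebra_simps)
  have eq_dn: "equideg ?A' (dn u) (dn v)" if "equideg ?A u v" "B dvd lookup u ?n" "B dvd lookup v ?n" for u v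
    using that keys_update_subset unfolding equideg_def dn_def
    by (auto simp: fun_eq_iff tdeg_append nth_default_scaleN simp flip: mult.assoc)
  have k_up: "keys (up u) = keys u" for u
    using B by (auto simp: up_def keys_update in_keys_iff)
  have k_dn: "keys (dn u) = keys u" if "B dvd lookup u ?n" for u
    using that k_up[of "dn u"] up_dn[OF that] by simp
  have cong': "B dvd lookup v ?n \<longleftrightarrow> B dvd lookup u ?n" if "equideg ?A u v" for u v
    using cong[OF that] by (simp add: dvd_eq_mod_eq_0)
  show "mu TYPE('k) ?A \<le> mu TYPE('k) ?A'"
  proof (rule mu_le_of_monomial_map[OF wf', of "\<lambda>u. single (up u) 1"])
    fix u v assume e: "equideg ?A' u v"
    then show "single (up u) (1::'k) - single (up v) 1 \<in> insert 0 (bins ?A)"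
      by (intro monomial_diff_in_bins eq_up)
    fix i assume "i \<in> keys u" "i \<in> keys v"
    then show "single (up u) (1::'k) - single (up v) 1 \<in> insert 0 (sbins ?A)"
      by (intro monomial_diff_in_sbins[OF eq_up[OF e]]) (simp_all add: k_up)
  next
    fix u v assume e: "equideg ?A u v" "keys u \<inter> keys v = {}"
    \<comment> \<open>With disjoint supports one of the two last exponents is 0, so the congruence
      makes both divisible by \<open>B\<close> and the binomial comes from
      \<open>dn\<close>.\<close>
    then have "lookup u ?n = 0 \<or> lookup v ?n = 0" by (auto simp: in_keys_iff disjoint_iff)
    then have "B dvd lookup u ?n" "B dvd lookup v ?n" using cong'[OF e(1)] by auto
    then show "\<exists>u' v'. equideg ?A' u' v' \<and> single (up u') 1 = single u (1::'k) \<and> single (up v') 1 = single v (1::'k)"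
      using eq_dn[OF e(1)] up_dn by metis
  qed
  \<comment> \<open>The map back discards monomials whose last exponent is not divisible by
    \<open>B\<close>; by \<open>cong'\<close> this never separates the two monomials of a
    binomial.\<close>
  let ?f = "\<lambda>u. if B dvd lookup u ?n then single (dn u) (1::'k) else 0"
  show "mu TYPE('k) ?A' \<le> mu TYPE('k) ?A"
  proof (rule mu_le_of_monomial_map[OF wf, of ?f])
    fix u v assume e: "equideg ?A u v"
    show "?f u - ?f v \<in> insert 0 (bins ?A')"
      using cong'[OF e] monomial_diff_in_bins[OF eq_dn[OF e], where ?'a = 'k] by auto
    fix i assume i: "i \<in> keys u" "i \<in> keys v"
    show "?f u - ?f v \<in> insert 0 (sbins ?A')"
      using cong'[OF e] i k_dn monomial_diff_in_sbins[OF eq_dn[OF e], of i, where ?'a = 'k] by auto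
  next
    fix u v assume e: "equideg ?A' u v"
    have "?f (up u) = single u 1" "?f (up v) = single v 1"
      by (simp_all add: dn_up) (simp_all add: up_def)
    then show "\<exists>u' v'. equideg ?A u' v' \<and> ?f u' = single u 1 \<and> ?f v' = single v 1"
      using eq_up[OF e] by blast
  qed
qed

section \<open>Appending a vector from the semigroup of the others\<close>

definition smul :: "nat \<Rightarrow> (nat \<Rightarrow>\<^sub>0 nat) \<Rightarrow> (nat \<Rightarrow>\<^sub>0 nat)" where
  "smul k w = Poly_Mapping.map ((*) k) w"

lemma lookup_smul [simp]: "lookup (smul k w) i = k * lookup w i"
  by (simp add: smul_def Poly_Mapping.map.rep_eq when_def)

lemma tdeg_smul [simp]: "tdeg A (smul k w) j = k * tdeg A w j"
  by (simp add: tdeg_def sum_distrib_left mult.assoc)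

text \<open>On exponents, the substitution of \<open>x\<^sup>w\<close> for
  \<open>x\<^sub>n\<close>.\<close>

definition subst_last :: "nat \<Rightarrow> (nat \<Rightarrow>\<^sub>0 nat) \<Rightarrow> (nat \<Rightarrow>\<^sub>0 nat) \<Rightarrow> (nat \<Rightarrow>\<^sub>0 nat)" where
  "subst_last n w u = upd n 0 u + smul (lookup u n) w"

text \<open>The exponent \<open>w\<close> witnesses that \<open>a\<close> lies in
  \<open>\<nat>A\<close>, so the ideal contains \<open>x\<^sub>n - x\<^sup>w\<close>, by which the
  last variable can be eliminated.\<close>

locale redundant_last =
  fixes m :: nat and A :: "nat list list" and a :: "nat list" and w :: "nat \<Rightarrow>\<^sub>0 nat"
  assumes wf: "wf_vecs m (A @ [a])"
    and kw: "keys w \<subseteq> {..<length A}"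
    and tw: "tdeg A w j = nth_default 0 a j"
begin

abbreviation "n \<equiv> length A"
abbreviation "A' \<equiv> A @ [a]"
abbreviation "sub \<equiv> subst_last n w"
abbreviation "xn \<equiv> single n (1::nat)"

lemma tdeg_sub [simp]: "tdeg A (sub u) j = tdeg A' u j"
  by (simp add: subst_last_def tdeg_add tw tdeg_append)

lemma keys_sub:
  assumes "keys u \<subseteq> {..<Suc n}" shows "keys (sub u) \<subseteq> {..<n}"
  unfolding subst_last_def keys_add_nat
  using assms kw by (auto simp: keys_update in_keys_iff subset_iff less_Suc_eq)

lemma w_nonzero: "w \<noteq> 0"
proof
  assume "w = 0"
  then have "nth_default 0 a j = 0" for j using tw[of j] by simp
  then have "a = replicate (length a) 0"
    by (intro nth_equalityI) (simp_all, metis nth_default_nth)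
  then show False using wf by simp
qed

lemma lookup_w_last: "lookup w n = 0"
  using kw by (auto simp: in_keys_iff subset_iff)

lemma sub_id: "lookup u n = 0 \<Longrightarrow> sub u = u"
  by (intro poly_mapping_eqI) (auto simp: subst_last_def lookup_add lookup_update)

lemma sub_var: "sub xn = w"
  by (intro poly_mapping_eqI) (simp add: subst_last_def lookup_add lookup_update lookup_single when_def)

lemma lookup_sub_last: "lookup (sub u) n = 0"
  by (simp add: subst_last_def lookup_add lookup_w_last)

lemma equideg_sub: "equideg A' u v \<Longrightarrow> equideg A (sub u) (sub v)"
  using keys_sub by (auto simp: equideg_def fun_eq_iff)

lemma equideg_lift: "equideg A u v \<Longrightarrow> equideg A' u v"
  using equideg_lookup_zero equideg_append_iff by blast

lemma equideg_self_sub: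
  assumes "keys u \<subseteq> {..<Suc n}" shows "equideg A' u (sub u)"
  using assms keys_sub[OF assms] 
  by (auto simp: equideg_def fun_eq_iff tdeg_append[of A a "sub u"] lookup_sub_last less_Suc_eq subset_iff)

text \<open>Lets \<open>sub\<close> act on the quotients. If the common variable is the last one, it
  is replaced by the variables of \<open>w\<close>, of which there is at least one because
  \<open>a\<close> is nonzero.\<close>

lemma share_sub:
  assumes "i \<in> keys u" "i \<in> keys v"
  shows "keys (sub u) \<inter> keys (sub v) \<noteq> {}"
proof (cases "i = n")
  case True
  obtain k where k: "k \<in> keys w" using w_nonzero by fastforce
  then have "k \<in> keys (sub u)" "k \<in> keys (sub v)"
    using True assms by (auto simp: subst_last_def keys_add_nat in_keys_iff)
  then show ?thesis by blast
next
  case False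
  then have "i \<in> keys (sub u)" "i \<in> keys (sub v)"
    using assms by (auto simp: subst_last_def keys_add_nat keys_update)
  then show ?thesis by blast
qed

text \<open>Such a binomial is a multiple of \<open>x\<^sub>n - x\<^sup>w\<close>. Modulo common
  variables it vanishes unless \<open>u\<close> is the variable \<open>x\<^sub>n\<close> itself:
  either nothing is substituted, or another variable of \<open>u\<close> survives, or a higher power
  of \<open>x\<^sub>n\<close> is treated factor by factor.\<close>

lemma bin_sub_in_span:
  assumes u: "keys u \<subseteq> {..<Suc n}"
  shows "bin u (sub u) \<in> vs.span ({bin xn w :: 'k::field mpol} \<union> sbins A')"
proof -
  have sh: "bin u (sub u) \<in> vs.span ({bin xn w :: 'k mpol} \<union> sbins A')"
    if "i \<in> keys u" "i \<in> keys (sub u)" for i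
    using bin_in_sbins[OF equideg_self_sub[OF u] that, where ?'a = 'k] by (simp add: vs.span_base)
  consider "lookup u n = 0" | "u = xn" | i where "i \<noteq> n" "i \<in> keys u" | "keys u = {n}" "lookup u n \<ge> 2"
  proof -
    have "u = xn" if "keys u \<subseteq> {n}" "lookup u n = 1"
      using that by (intro poly_mapping_eqI) (auto simp: lookup_single when_def in_keys_iff subset_iff)
    moreover have "keys u = {n}" if "keys u \<subseteq> {n}" "lookup u n \<noteq> 0"
      using that by (auto simp: in_keys_iff)
    moreover have "lookup u n = 0 \<or> lookup u n = 1 \<or> lookup u n \<ge> 2" by auto
    ultimately show ?thesis using that by blast
  qed
  then show ?thesis
  proof cases
    case 1
    then show ?thesis by (simp add: sub_id vs.span_zero)
  next
    case 2
    show ?thesis unfolding 2 sub_var by (rule vs.span_base) simp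
  next
    case (3 i)
    then have "i \<in> keys (sub u)" by (simp add: subst_last_def keys_add_nat keys_update)
    with 3 sh show ?thesis by blast
  next
    case 4
    \<comment> \<open>Substitute for one factor \<open>x\<^sub>n\<close> at a time: both differences have a common variable.\<close>
    define z where "z = upd n (lookup u n - 1) u + w"
    have lz: "lookup z n = lookup u n - 1" by (simp add: z_def lookup_add lookup_w_last)
    obtain k where k: "k \<in> keys w" using w_nonzero by fastforce
    have kz: "keys z \<subseteq> {..<Suc n}"
      using u kw keys_update_subset[OF u] by (auto simp: z_def keys_add_nat)
    have "tdeg A' u j = tdeg A' z j" for j
      using 4 by (simp add: tdeg_append lz) (simp add: z_def tdeg_add tw flip: mult_Suc)
    then have e: "equideg A' u z" using u kz by (auto simp: equideg_def)
    have "sub z = sub u"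
    proof (rule poly_mapping_eqI)
      fix i
      have "lookup (sub z) i = lookup (upd n 0 u) i + lookup w i + (lookup u n - 1) * lookup w i"
        using lookup_w_last
        by (auto simp: subst_last_def lookup_add lookup_update lz) (auto simp: z_def lookup_add lookup_update)
      also have "\<dots> = lookup (sub u) i"
        using 4(2) by (simp add: subst_last_def lookup_add flip: mult_Suc)
      finally show "lookup (sub z) i = lookup (sub u) i" .
    qed
    then have e': "equideg A' z (sub u)" using equideg_self_sub[OF kz] by simp
    have "n \<in> keys u" "n \<in> keys z" using 4 lz by (auto simp: in_keys_iff)
    then have "bin u z \<in> (sbins A' :: 'k mpol set)" by (rule bin_in_sbins[OF e])
    moreover have "k \<in> keys z" "k \<in> keys (sub u)"
      using k 4(2) by (auto simp: z_def subst_last_def keys_add_nat in_keys_iff)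
    then have "bin z (sub u) \<in> (sbins A' :: 'k mpol set)" by (rule bin_in_sbins[OF e'])
    ultimately have "bin u z + bin z (sub u) \<in> vs.span ({bin xn w :: 'k mpol} \<union> sbins A')"
      by (intro vs.span_add vs.span_base) auto
    then show ?thesis by (simp add: bin_def)
  qed
qed

lemma equideg_var_w: "equideg A' xn w"
  using equideg_self_sub[of xn] unfolding sub_var by simp

text \<open>The inclusion of \<open>I\<^sub>A\<close> with the single extra generator
  \<open>bin xn w\<close> suffices: substituting in both monomials of a binomial leaves a binomial
  of \<open>A\<close> and two differences covered by \<open>bin_sub_in_span\<close>.\<close>

lemma mu_append_le: "mu TYPE('k::field) A' \<le> Suc (mu TYPE('k) A)"
proof -
  let ?E = "{bin xn w :: 'k mpol}"
  have "mu TYPE('k) A' \<le> mu TYPE('k) A + card ?E"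
  proof (rule mu_le_of_lin[of m _ "\<lambda>p. p"])
    show "wf_vecs m A" using wf by simp
    show "lin (\<lambda>p :: 'k mpol. p)" by (rule linI) auto
    have b: "bins A \<subseteq> (bins A' :: 'k mpol set)"
      using equideg_lift by (auto simp: bins_def)
    then show "(\<lambda>p. p) ` bins A \<subseteq> vs.span (bins A' :: 'k mpol set)" by (auto intro: vs.span_base)
    have "sbins A \<subseteq> (sbins A' :: 'k mpol set)"
      using equideg_lift unfolding sbins_def by blast
    then show "(\<lambda>p. p) ` sbins A \<subseteq> vs.span (sbins A' :: 'k mpol set)" by (auto intro: vs.span_base)
    show "?E \<subseteq> vs.span (bins A')" using equideg_var_w by (auto intro!: vs.span_base bin_in_bins)
    let ?V = "vs.span ((\<lambda>p. p) ` bins A \<union> ?E \<union> sbins A')"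
    have "bin u v \<in> ?V" if e: "equideg A' u v" for u v
    proof -
      have k: "keys u \<subseteq> {..<Suc n}" "keys v \<subseteq> {..<Suc n}" using e by (auto simp: equideg_def)
      have sp: "vs.span (?E \<union> sbins A') \<subseteq> ?V" by (rule vs.span_mono) auto
      have "bin u (sub u) \<in> ?V" "bin v (sub v) \<in> ?V" using bin_sub_in_span k sp by blast+
      moreover have "bin (sub u) (sub v) \<in> ?V"
        using equideg_sub[OF e] by (intro vs.span_base) (auto intro: bin_in_bins)
      ultimately have "bin u (sub u) + bin (sub u) (sub v) - bin v (sub v) \<in> ?V"
        by (intro vs.span_diff vs.span_add)
      then show ?thesis by (simp add: bin_def)
    qed
    then show "bins A' \<subseteq> ?V" unfolding bins_def[of A'] by blast
  qed simp
  then show ?thesis by simp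
qed

text \<open>The coefficient of \<open>x\<^sub>n\<close> will detect the new generator. A monomial of
  the same degree that shares a variable with \<open>x\<^sub>n\<close> is \<open>x\<^sub>n\<close>
  times a monomial of degree 0, and that factor is 1.\<close>

lemma lookup_sbins_var:
  assumes "p \<in> (sbins A' :: 'k::field mpol set)" shows "lookup p xn = 0"
proof -
  have key: "u = v" if "equideg A' u v" "i \<in> keys u" "i \<in> keys v" "u = xn" for u v i
  proof -
    have "i = n" using that by simp
    then have "v = xn + (v - xn)" using split_off_var[of n v] that by simp
    then have "equideg A' 0 (v - xn)" using that equideg_cancel[of A' xn 0 "v - xn"] by simp
    then have "v - xn = 0" using equideg_zero[OF wf equideg_sym] by blast
    then show ?thesis using \<open>v = xn + (v - xn)\<close> that by simp
  qed
  obtain u v i where uv: "p = bin u v" "equideg A' u v" "i \<in> keys u" "i \<in> keys v"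
    using assms unfolding sbins_def by blast
  then show ?thesis
    using key[OF uv(2,3,4)] key[OF equideg_sym[OF uv(2)] uv(4,3)]
    by (auto simp: bin_def lookup_minus lookup_single when_def)
qed

text \<open>From a smallest spanning set for \<open>A'\<close> one element can be spared: clear the
  coefficient of \<open>x\<^sub>n\<close> with some \<open>g\<close>, then substitute for the last
  variable. The result spans for \<open>A\<close>, and \<open>g\<close> has become 0.\<close>

lemma mu_append_ge: "Suc (mu TYPE('k::field) A) \<le> mu TYPE('k) A'"
proof -
  obtain S :: "'k mpol set" where S: "spans_mod A' S" "card S = mu TYPE('k) A'"
    using mu_attained[OF wf] .
  have S': "finite S" "S \<subseteq> vs.span (bins A')" "bins A' \<subseteq> vs.span (S \<union> sbins A')"
    using S(1) by (auto simp: spans_mod_def)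
  have "w \<noteq> xn" using lookup_w_last by auto
  \<comment> \<open>Otherwise the coefficient of \<open>x\<^sub>n\<close> would vanish on the whole
    span, yet it is 1 in \<open>bin xn w\<close>.\<close>
  obtain g where g: "g \<in> S" "lookup g xn \<noteq> 0"
  proof (rule ccontr)
    assume "\<not> thesis"
    then have "S \<union> sbins A' \<subseteq> {p. lookup p xn = 0}" using that lookup_sbins_var by blast
    moreover have "vs.subspace {p :: 'k mpol. lookup p xn = 0}"
      by (auto simp: vs.subspace_def lookup_add)
    ultimately have "vs.span (S \<union> sbins A') \<subseteq> {p. lookup p xn = 0}" by (rule vs.span_minimal)
    moreover have "bin xn w \<in> vs.span (S \<union> sbins A')" using S'(3) equideg_var_w bin_in_bins by blast
    ultimately have "lookup (bin xn w :: 'k mpol) xn = 0" by blast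
    then show False using \<open>w \<noteq> xn\<close> by (simp add: bin_def lookup_minus lookup_single)
  qed
  \<comment> \<open>Elimination with pivot \<open>g\<close>: \<open>Q\<close> sends \<open>g\<close>
    to 0 and fixes every polynomial without the monomial \<open>x\<^sub>n\<close>, among them
    \<open>sbins A'\<close> and \<open>bins A\<close>.\<close>
  define Q where "Q p = p - scl (lookup p xn / lookup g xn) g" for p
  define L :: "'k mpol \<Rightarrow> 'k mpol" where "L = ext (\<lambda>u. single (sub u) 1)"
  have "lin Q"
    by (rule linI) (auto intro!: poly_mapping_eqI
        simp: Q_def lookup_add lookup_minus add_divide_distrib algebra_simps)
  moreover have "lin L" unfolding L_def by (rule lin_ext)
  ultimately have linLQ: "lin (L \<circ> Q)" by (rule Vector_Spaces.linear_compose)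
  have Lbin: "L (bin u v) = bin (sub u) (sub v)" for u v
    by (simp add: L_def ext_bin) (simp add: bin_def)
  have Qid: "Q p = p" if "lookup p xn = 0" for p using that by (simp add: Q_def)
  have Lbins: "L ` bins A' \<subseteq> vs.span (bins A)"
    by (auto simp: bins_def[of A'] Lbin intro!: vs.span_base bin_in_bins equideg_sub)
  have "spans_mod A ((L \<circ> Q) ` S \<union> {})"
  proof (rule spans_mod_image[OF linLQ _ _ _ _ _ S(1)])
    have "Q p \<in> vs.span (bins A')" if "p \<in> bins A'" for p
      unfolding Q_def using that g(1) S'(2) by (intro vs.span_diff vs.span_scale) (auto intro: vs.span_base)
    then show "(L \<circ> Q) ` bins A' \<subseteq> vs.span (bins A)"
      using lin_span_image_subset[OF \<open>lin L\<close> Lbins] by auto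
    have "(L \<circ> Q) p \<in> sbins A" if p: "p \<in> sbins A'" for p :: "'k mpol"
    proof -
      obtain u v i where uv: "p = bin u v" "equideg A' u v" "i \<in> keys u" "i \<in> keys v"
        using p unfolding sbins_def by blast
      have "bin (sub u) (sub v) \<in> (sbins A :: 'k mpol set)"
        using equideg_sub[OF uv(2)] share_sub[OF uv(3,4)] by (auto simp: sbins_def)
      then show ?thesis using lookup_sbins_var[OF p] uv(1) by (simp add: Qid Lbin)
    qed
    then show "(L \<circ> Q) ` sbins A' \<subseteq> vs.span (sbins A)" by (auto intro: vs.span_base)
    have "bin u v \<in> (L \<circ> Q) ` bins A'" if e: "equideg A u v" for u v
    proof
      have z: "lookup u n = 0" "lookup v n = 0" using equideg_lookup_zero[OF e] by auto
      then have "u \<noteq> xn" "v \<noteq> xn" by auto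
      then have "lookup (bin u v :: 'k mpol) xn = 0"
        by (simp add: bin_def lookup_minus lookup_single)
      then show "bin u v = (L \<circ> Q) (bin u v)" using z by (simp add: Qid Lbin sub_id)
      show "bin u v \<in> (bins A' :: 'k mpol set)" using equideg_lift[OF e] by (rule bin_in_bins)
    qed
    then have "bins A \<subseteq> (L \<circ> Q) ` bins A' \<union> {} \<union> sbins A"
      unfolding bins_def[of A] by blast
    then show "bins A \<subseteq> vs.span ((L \<circ> Q) ` bins A' \<union> {} \<union> sbins A)"
      using vs.span_superset by (rule order_trans)
  qed auto
  moreover have "(L \<circ> Q) ` S = insert 0 ((L \<circ> Q) ` (S - {g}))"
  proof -
    have "Q g = 0" using g(2) by (simp add: Q_def)
    then have "(L \<circ> Q) g = 0" by (simp add: vp.linear_0[OF \<open>lin L\<close>])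
    then show ?thesis using g(1) by (metis image_insert insert_Diff)
  qed
  ultimately have "spans_mod A ((L \<circ> Q) ` (S - {g}))"
    by (simp add: spans_mod_def)
  then have "mu TYPE('k) A \<le> card ((L \<circ> Q) ` (S - {g}))" by (rule mu_le)
  also have "\<dots> \<le> card (S - {g})" using S'(1) by (intro card_image_le) simp
  also have "\<dots> < card S" using S'(1) g(1) by (rule card_Diff1_less)
  finally show ?thesis using S(2) by simp
qed

lemma mu_append_redundant: "mu TYPE('k::field) A' = Suc (mu TYPE('k) A)"
  by (rule antisym[OF mu_append_le mu_append_ge])

end

section \<open>Ranks and multiples\<close>

text \<open>Moves the vectors into a rational vector space with span, independence and dimension.
  Trailing zeros are lost, so injectivity holds among lists of one length.\<close>

definition vec :: "nat list \<Rightarrow> (nat \<Rightarrow>\<^sub>0 rat)" where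
  "vec a = Poly_Mapping.nth (map rat_of_nat a)"

lemma lookup_vec: "lookup (vec a) j = (if j < length a then of_nat (a ! j) else 0)"
  by (simp add: vec_def nth_default_def)

lemma inj_on_vec: "inj_on vec {a. length a = m}"
proof (rule inj_onI)
  fix a b assume l: "a \<in> {a. length a = m}" "b \<in> {a. length a = m}" and e: "vec a = vec b"
  then show "a = b"
    by (intro nth_equalityI) (auto, metis lookup_vec of_nat_eq_iff)
qed

lemma vec_eq_sum_iff:
  assumes "\<forall>b\<in>S. length b = m" "length v = m"
  shows "vec v = (\<Sum>b\<in>S. scl (c b) (vec b)) \<longleftrightarrow> (\<forall>j<m. of_nat (v ! j) = (\<Sum>b\<in>S. c b * of_nat (b ! j)))"
  (is "?l \<longleftrightarrow> ?r")
proof -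
  have *: "lookup (\<Sum>b\<in>S. scl (c b) (vec b)) j = (if j < m then (\<Sum>b\<in>S. c b * of_nat (b ! j)) else 0)" for j
    using assms(1) by (simp add: lookup_sum lookup_vec)
  have "?l \<longleftrightarrow> (\<forall>j. lookup (vec v) j = lookup (\<Sum>b\<in>S. scl (c b) (vec b)) j)"
    by (metis poly_mapping_eqI)
  then show ?thesis using assms(2) unfolding * lookup_vec by auto
qed

lemma sum_vec_eq_zero_iff:
  assumes "\<forall>b\<in>S. length b = m"
  shows "(\<Sum>b\<in>S. scl (c b) (vec b)) = 0 \<longleftrightarrow> (\<forall>j<m. (\<Sum>b\<in>S. c b * of_nat (b ! j)) = 0)"
proof -
  have *: "lookup (\<Sum>b\<in>S. scl (c b) (vec b)) j = (if j < m then (\<Sum>b\<in>S. c b * of_nat (b ! j)) else 0)" for j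
    using assms(1) by (simp add: lookup_sum lookup_vec)
  have "(\<Sum>b\<in>S. scl (c b) (vec b)) = 0 \<longleftrightarrow> (\<forall>j. lookup (\<Sum>b\<in>S. scl (c b) (vec b)) j = 0)"
    by (metis poly_mapping_eqI lookup_zero)
  then show ?thesis unfolding * by auto
qed

text \<open>The two sides index the coefficients differently, by lists and by their images;
  injectivity of \<open>vec\<close> translates one into the other.\<close>

lemma inQspan_iff:
  assumes "finite S" "\<forall>b\<in>S. length b = m" "length v = m"
  shows "inQspan m S v \<longleftrightarrow> vec v \<in> vs.span (vec ` S)"
proof -
  have inj: "inj_on vec S" using inj_on_vec[of m] assms(2) by (auto intro: inj_on_subset)
  have "vec v \<in> vs.span (vec ` S) \<longleftrightarrow> (\<exists>u. vec v = (\<Sum>b\<in>S. scl (u (vec b)) (vec b)))"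
    using assms(1) inj by (auto simp: vs.span_finite sum.reindex)
  also have "\<dots> \<longleftrightarrow> (\<exists>c. vec v = (\<Sum>b\<in>S. scl (c b) (vec b)))"
  proof
    assume "\<exists>c. vec v = (\<Sum>b\<in>S. scl (c b) (vec b))"
    then obtain c where c: "vec v = (\<Sum>b\<in>S. scl (c b) (vec b))" by blast
    have "vec v = (\<Sum>b\<in>S. scl ((c \<circ> the_inv_into S vec) (vec b)) (vec b))"
      unfolding c by (intro sum.cong) (simp_all add: the_inv_into_f_f[OF inj])
    then show "\<exists>u. vec v = (\<Sum>b\<in>S. scl (u (vec b)) (vec b))" by blast
  next
    assume "\<exists>u. vec v = (\<Sum>b\<in>S. scl (u (vec b)) (vec b))"
    then obtain u where "vec v = (\<Sum>b\<in>S. scl ((u \<circ> vec) b) (vec b))" by auto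
    then show "\<exists>c. vec v = (\<Sum>b\<in>S. scl (c b) (vec b))" by blast
  qed
  finally show ?thesis unfolding inQspan_def vec_eq_sum_iff[OF assms(2,3)] by blast
qed

lemma lin_indep_Q_iff:
  assumes "finite T" "\<forall>b\<in>T. length b = m"
  shows "lin_indep_Q m T \<longleftrightarrow> vs.independent (vec ` T)"
proof -
  have inj: "inj_on vec T" using inj_on_vec[of m] assms(2) by (auto intro: inj_on_subset)
  have "vs.independent (vec ` T) \<longleftrightarrow>
      (\<forall>u. (\<Sum>b\<in>T. scl (u (vec b)) (vec b)) = 0 \<longrightarrow> (\<forall>b\<in>T. u (vec b) = 0))"
    using assms(1) inj by (auto simp: vs.dependent_finite sum.reindex)
  also have "\<dots> \<longleftrightarrow> (\<forall>c. (\<Sum>b\<in>T. scl (c b) (vec b)) = 0 \<longrightarrow> (\<forall>b\<in>T. c b = 0))"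
  proof
    assume *: "\<forall>u. (\<Sum>b\<in>T. scl (u (vec b)) (vec b)) = 0 \<longrightarrow> (\<forall>b\<in>T. u (vec b) = 0)"
    show "\<forall>c. (\<Sum>b\<in>T. scl (c b) (vec b)) = 0 \<longrightarrow> (\<forall>b\<in>T. c b = 0)"
    proof (intro allI impI)
      fix c assume "(\<Sum>b\<in>T. scl (c b) (vec b)) = 0"
      then have "(\<Sum>b\<in>T. scl ((c \<circ> the_inv_into T vec) (vec b)) (vec b)) = 0"
        by (subst sum.cong[OF refl, of _ _ "\<lambda>b. scl (c b) (vec b)"]) (simp_all add: the_inv_into_f_f[OF inj])
      then have "\<forall>b\<in>T. (c \<circ> the_inv_into T vec) (vec b) = 0" using * by blast
      then show "\<forall>b\<in>T. c b = 0" by (simp add: the_inv_into_f_f[OF inj])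
    qed
  next
    assume *: "\<forall>c. (\<Sum>b\<in>T. scl (c b) (vec b)) = 0 \<longrightarrow> (\<forall>b\<in>T. c b = 0)"
    show "\<forall>u. (\<Sum>b\<in>T. scl (u (vec b)) (vec b)) = 0 \<longrightarrow> (\<forall>b\<in>T. u (vec b) = 0)"
    proof
      fix u show "(\<Sum>b\<in>T. scl (u (vec b)) (vec b)) = 0 \<longrightarrow> (\<forall>b\<in>T. u (vec b) = 0)"
        using *[THEN spec, of "\<lambda>b. u (vec b)"] .
    qed
  qed
  finally show ?thesis unfolding lin_indep_Q_def sum_vec_eq_zero_iff[OF assms(2)] by blast
qed

text \<open>A basis can be chosen among the given vectors and attains the maximum; independent
  subsets are no larger than a basis.\<close>

lemma lattice_rank_eq_dim:
  assumes len: "\<forall>a\<in>set A. length a = m"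
  shows "lattice_rank m A = vs.dim (vec ` set A)"
  unfolding lattice_rank_def
proof (rule Max_eqI)
  let ?X = "{card T |T. T \<subseteq> set A \<and> lin_indep_Q m T}"
  have inj: "inj_on vec (set A)" using inj_on_vec[of m] len by (auto intro: inj_on_subset)
  have ind: "lin_indep_Q m T \<longleftrightarrow> vs.independent (vec ` T)" if "T \<subseteq> set A" for T
    using that len finite_subset[OF that] by (intro lin_indep_Q_iff) auto
  obtain B where B: "B \<subseteq> vec ` set A" "vs.independent B" "vec ` set A \<subseteq> vs.span B" "card B = vs.dim (vec ` set A)"
    using vs.basis_exists by blast
  have finB: "finite B" using B(1) finite_surj by blast
  have "?X = card ` {T. T \<subseteq> set A \<and> lin_indep_Q m T}" by auto
  then show "finite ?X" by simp
  show "c \<le> vs.dim (vec ` set A)" if c: "c \<in> ?X" for c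
  proof -
    obtain T where T: "c = card T" "T \<subseteq> set A" "vs.independent (vec ` T)" using c ind by auto
    have "vec ` T \<subseteq> vs.span B" using T(2) B(3) by blast
    then have "card (vec ` T) \<le> card B" using vs.independent_span_bound[OF finB T(3)] by blast
    then show ?thesis using T(1) B(4) card_image[OF inj_on_subset[OF inj T(2)]] by simp
  qed
  obtain T where T: "T \<subseteq> set A" "B = vec ` T" using B(1) subset_imageE by metis
  have "card T = vs.dim (vec ` set A)"
    using B(4) card_image[OF inj_on_subset[OF inj T(1)]] T(2) by simp
  then show "vs.dim (vec ` set A) \<in> ?X"
    using T B(2) ind[OF T(1)] by (intro CollectI exI[of _ T]) simp
qed

text \<open>Guards the truncated subtraction in the height
  \<open>length A - lattice_rank m A\<close>.\<close>

lemma lattice_rank_le_length: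
  assumes "\<forall>a\<in>set A. length a = m" shows "lattice_rank m A \<le> length A"
proof -
  have "vs.dim (vec ` set A) \<le> card (vec ` set A)"
    by (rule vs.dim_le_card) (auto intro: vs.span_base)
  also have "\<dots> \<le> card (set A)" by (rule card_image_le) simp
  also have "\<dots> \<le> length A" by (rule card_length)
  finally show ?thesis using lattice_rank_eq_dim[OF assms] by simp
qed

lemma lattice_rank_append_in:
  assumes "\<forall>a\<in>set (A @ [a]). length a = m" "inQspan m (set A) a"
  shows "lattice_rank m (A @ [a]) = lattice_rank m A"
proof -
  have "vec a \<in> vs.span (vec ` set A)" using assms by (subst inQspan_iff[symmetric]) auto
  then have "vs.span (insert (vec a) (vec ` set A)) = vs.span (vec ` set A)" by (rule vs.span_redundant)
  then have "vs.dim (insert (vec a) (vec ` set A)) = vs.dim (vec ` set A)" by (rule vs.span_eq_dim)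
  then show ?thesis using assms(1) by (simp add: lattice_rank_eq_dim)
qed

lemma lattice_rank_append_notin:
  assumes "\<forall>a\<in>set (A @ [a]). length a = m" "\<not> inQspan m (set A) a"
  shows "lattice_rank m (A @ [a]) = Suc (lattice_rank m A)"
proof -
  have a: "vec a \<notin> vs.span (vec ` set A)" using assms by (subst inQspan_iff[symmetric]) auto
  obtain B where B: "B \<subseteq> vec ` set A" "vs.independent B" "vec ` set A \<subseteq> vs.span B" "card B = vs.dim (vec ` set A)"
    using vs.basis_exists by blast
  have sp: "vs.span B = vs.span (vec ` set A)"
    using B(1,3) by (auto simp: vs.span_eq intro: vs.span_base)
  have fin: "finite B" using B(1) finite_surj by blast
  have "vs.dim (insert (vec a) (vec ` set A)) = card (insert (vec a) B)"
  proof (rule vs.dim_eq_card)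
    show "vs.span (insert (vec a) B) = vs.span (insert (vec a) (vec ` set A))"
      using sp by (simp add: vs.span_insert)
    show "vs.independent (insert (vec a) B)" using a sp B(2) by (simp add: vs.independent_insertI)
  qed
  also have "\<dots> = Suc (card B)" using fin a sp by (subst card_insert_disjoint) (auto dest: vs.span_base)
  finally show ?thesis using assms(1) B(4) by (simp add: lattice_rank_eq_dim)
qed

lemma lattice_rank_set_cong: "set A = set A' \<Longrightarrow> lattice_rank m A = lattice_rank m A'"
  by (simp add: lattice_rank_def)

section \<open>Integer multiples of a vector in the lattice of the others\<close>

definition int_mult_in :: "nat \<Rightarrow> nat list set \<Rightarrow> nat list \<Rightarrow> int \<Rightarrow> bool" where
  "int_mult_in m S a k \<longleftrightarrow> (\<exists>c. \<forall>j<m. k * int (a ! j) = (\<Sum>b\<in>S. c b * int (b ! j)))"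

lemma inZspan_scaleN_iff:
  "length a = m \<Longrightarrow> inZspan m S (scaleN b a) \<longleftrightarrow> int_mult_in m S a (int b)"
  by (simp add: inZspan_def int_mult_in_def scaleN_def)

text \<open>The admissible multipliers form a subgroup of the integers. They are taken in
  \<open>int\<close> so that this closure property supports division with remainder.\<close>

lemma int_mult_in_diff:
  assumes "int_mult_in m S a k" "int_mult_in m S a l"
  shows "int_mult_in m S a (k - q * l)"
proof -
  obtain c d where c: "\<forall>j<m. k * int (a ! j) = (\<Sum>b\<in>S. c b * int (b ! j))"
    and d: "\<forall>j<m. l * int (a ! j) = (\<Sum>b\<in>S. d b * int (b ! j))"
    using assms by (auto simp: int_mult_in_def)
  have "(k - q * l) * int (a ! j) = (\<Sum>b\<in>S. (c b - q * d b) * int (b ! j))" if "j < m" for j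
  proof -
    have "(k - q * l) * int (a ! j) = k * int (a ! j) - q * (l * int (a ! j))"
      by (simp add: algebra_simps)
    also have "\<dots> = (\<Sum>b\<in>S. c b * int (b ! j)) - q * (\<Sum>b\<in>S. d b * int (b ! j))"
      using c d that by (simp only:)
    also have "\<dots> = (\<Sum>b\<in>S. (c b - q * d b) * int (b ! j))"
      by (simp add: left_diff_distrib sum_subtractf sum_distrib_left mult.assoc)
    finally show ?thesis .
  qed
  then show ?thesis
    unfolding int_mult_in_def by (intro exI[of _ "\<lambda>b. c b - q * d b"]) simp
qed

lemma int_mult_in_imp_inQspan:
  assumes "int_mult_in m S a k" "k \<noteq> 0"
  shows "inQspan m S a"
proof -
  obtain c where c: "\<forall>j<m. k * int (a ! j) = (\<Sum>b\<in>S. c b * int (b ! j))"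
    using assms by (auto simp: int_mult_in_def)
  have "rat_of_nat (a ! j) = (\<Sum>b\<in>S. of_int (c b) / of_int k * of_nat (b ! j))" if "j < m" for j
  proof -
    have "rat_of_int k * of_nat (a ! j) = of_int (k * int (a ! j))" by simp
    also have "\<dots> = (\<Sum>b\<in>S. of_int (c b) * of_nat (b ! j))" using c that by simp
    finally show ?thesis using assms(2) by (simp add: field_simps flip: sum_divide_distrib)
  qed
  then show ?thesis unfolding inQspan_def by (intro exI[of _ "\<lambda>b. of_int (c b) / of_int k"]) blast
qed

lemma common_denominator:
  fixes c :: "'a \<Rightarrow> rat"
  assumes "finite S"
  shows "\<exists>N>0. \<exists>z. \<forall>b\<in>S. of_nat N * c b = of_int (z b)"
  using assms
proof (induction S rule: finite_induct)
  case empty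
  then show ?case by auto
next
  case (insert x S)
  then obtain N z where N: "N > 0" "\<forall>b\<in>S. of_nat N * c b = of_int (z b)" by blast
  obtain p q where q: "q > 0" "c x = of_int p / of_int q"
    by (metis quotient_of_div quotient_of_denom_pos surj_pair)
  have "\<forall>b\<in>insert x S. of_nat (N * nat q) * c b = of_int (if b = x then int N * p else q * z b)"
    using N q insert.hyps by (auto simp: field_simps)
  moreover have "N * nat q > 0" using N q by simp
  ultimately show ?case by (intro exI[of _ "N * nat q"] conjI exI[of _ "\<lambda>b. if b = x then int N * p else q * z b"])
qed

lemma inQspan_imp_int_mult_in:
  assumes "finite S" "inQspan m S a"
  obtains N :: nat where "N > 0" "int_mult_in m S a (int N)"
proof -
  obtain c :: "nat list \<Rightarrow> rat" where c: "\<forall>j<m. of_nat (a ! j) = (\<Sum>b\<in>S. c b * of_nat (b ! j))"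
    using assms(2) by (auto simp: inQspan_def)
  obtain N z where N: "N > 0" "\<forall>b\<in>S. of_nat N * c b = of_int (z b)"
    using common_denominator[OF assms(1)] by blast
  have "int N * int (a ! j) = (\<Sum>b\<in>S. z b * int (b ! j))" if "j < m" for j
  proof -
    have "rat_of_int (int N * int (a ! j)) = (\<Sum>b\<in>S. of_nat N * c b * of_nat (b ! j))"
      using c that by (simp add: sum_distrib_left mult.assoc)
    also have "\<dots> = of_int (\<Sum>b\<in>S. z b * int (b ! j))" using N(2) by simp
    finally show ?thesis by (simp only: of_int_eq_iff)
  qed
  then have "int_mult_in m S a (int N)" unfolding int_mult_in_def by (intro exI[of _ z]) simp
  with N(1) show thesis by (rule that)
qed

text \<open>Equate the two degrees and bring all terms except those of \<open>a\<close> to one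
  side.\<close>

lemma equideg_imp_int_mult_in:
  assumes "wf_vecs m (R @ [a])" "equideg (R @ [a]) u v"
  shows "int_mult_in m (set R) a (int (lookup u (length R)) - int (lookup v (length R)))"
proof -
  let ?n = "length R"
  \<comment> \<open>Lattice membership is indexed by the set of vectors, so the exponents of equal
    entries of \<open>R\<close> are collected in one coefficient.\<close>
  define c where "c b = (\<Sum>i | i < ?n \<and> R ! i = b. int (lookup v i) - int (lookup u i))" for b
  have "(int (lookup u ?n) - int (lookup v ?n)) * int (a ! j) = (\<Sum>b\<in>set R. c b * int (b ! j))"
    if j: "j < m" for j
  proof -
    have nd: "nth_default 0 (R ! i) j = R ! i ! j" if "i < ?n" for i
      using assms(1) j that by (auto simp: wf_vecs_def nth_default_def)
    have nda: "nth_default 0 a j = a ! j" using assms(1) j by (simp add: nth_default_def)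
    have td: "int (tdeg R w j) = (\<Sum>i<?n. int (lookup w i) * int (R ! i ! j))" for w
      unfolding tdeg_def by (simp add: nd)
    have "tdeg (R @ [a]) u j = tdeg (R @ [a]) v j" using assms(2) by (simp add: equideg_def)
    then have "tdeg R u j + lookup u ?n * a ! j = tdeg R v j + lookup v ?n * a ! j"
      by (simp add: tdeg_append nda)
    then have "int (tdeg R u j) + int (lookup u ?n) * int (a ! j) = int (tdeg R v j) + int (lookup v ?n) * int (a ! j)"
      by (metis of_nat_add of_nat_mult)
    then have "(int (lookup u ?n) - int (lookup v ?n)) * int (a ! j)
        = (\<Sum>i<?n. (int (lookup v i) - int (lookup u i)) * int (R ! i ! j))"
      unfolding td by (simp add: left_diff_distrib sum_subtractf)
    also have "\<dots> = (\<Sum>b\<in>(!) R ` {..<?n}. \<Sum>i | i \<in> {..<?n} \<and> R ! i = b. (int (lookup v i) - int (lookup u i)) * int (R ! i ! j))"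
      by (rule sum.image_gen) simp
    also have "(!) R ` {..<?n} = set R" by (auto simp: set_conv_nth)
    also have "(\<Sum>b\<in>set R. \<Sum>i | i \<in> {..<?n} \<and> R ! i = b. (int (lookup v i) - int (lookup u i)) * int (R ! i ! j))
        = (\<Sum>b\<in>set R. c b * int (b ! j))"
      unfolding c_def sum_distrib_right by (intro sum.cong) auto
    finally show ?thesis .
  qed
  then show ?thesis unfolding int_mult_in_def by (intro exI[of _ c]) simp
qed

text \<open>Clearing denominators in a rational combination gives some positive multiplier, so the
  \<open>LEAST\<close> in \<open>minB\<close> is attained.\<close>

lemma minB_props:
  assumes "length a = m" "finite S" "inQspan m S a"
  shows "minB m S a > 0" "int_mult_in m S a (int (minB m S a))"
    "\<And>b. b > 0 \<Longrightarrow> int_mult_in m S a (int b) \<Longrightarrow> minB m S a \<le> b"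
proof -
  have def: "minB m S a = (LEAST b. b > 0 \<and> int_mult_in m S a (int b))"
    by (simp add: minB_def inZspan_scaleN_iff[OF assms(1)])
  obtain N :: nat where "N > 0 \<and> int_mult_in m S a (int N)"
    using inQspan_imp_int_mult_in[OF assms(2,3)] by blast
  from LeastI[of "\<lambda>b. b > 0 \<and> int_mult_in m S a (int b)", OF this]
  show "minB m S a > 0" "int_mult_in m S a (int (minB m S a))" unfolding def by auto
  show "minB m S a \<le> b" if "b > 0" "int_mult_in m S a (int b)" for b
    unfolding def using that by (intro Least_le) simp
qed

text \<open>The difference of the last exponents is a multiplier, hence so is its remainder modulo
  \<open>minB\<close>; a nonzero remainder would contradict minimality. This is the congruence that
  \<open>mu_append_scale\<close> assumes.\<close>

lemma equideg_mod_minB: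
  assumes wf: "wf_vecs m (R @ [a])" and Q: "inQspan m (set R) a" and e: "equideg (R @ [a]) u v"
  shows "lookup u (length R) mod minB m (set R) a = lookup v (length R) mod minB m (set R) a"
proof -
  let ?B = "minB m (set R) a" and ?d = "int (lookup u (length R)) - int (lookup v (length R))"
  have l: "length a = m" using wf by simp
  note B = minB_props[OF l finite_set Q]
  have "int_mult_in m (set R) a (?d - (?d div int ?B) * int ?B)"
    by (rule int_mult_in_diff[OF equideg_imp_int_mult_in[OF wf e] B(2)])
  then have r: "int_mult_in m (set R) a (?d mod int ?B)"
    by (simp add: minus_div_mult_eq_mod)
  have "?d mod int ?B = 0"
  proof (rule ccontr)
    assume "?d mod int ?B \<noteq> 0"
    moreover have "0 \<le> ?d mod int ?B" "?d mod int ?B < int ?B" using B(1) by auto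
    ultimately have "nat (?d mod int ?B) > 0" "nat (?d mod int ?B) < ?B" by linarith+
    then show False using B(3)[of "nat (?d mod int ?B)"] r by simp
  qed
  then have "int (lookup u (length R)) mod int ?B = int (lookup v (length R)) mod int ?B"
    by (simp add: mod_eq_dvd_iff dvd_eq_mod_eq_0)
  then show ?thesis by (simp flip: zmod_int)
qed

lemma inNspan_exponent:
  assumes "\<forall>b\<in>set R. length b = m" "length a = m" "inNspan m (set R) a"
  obtains w where "keys w \<subseteq> {..<length R}" "\<And>j. tdeg R w j = nth_default 0 a j"
proof -
  obtain c where c: "\<forall>j<m. a ! j = (\<Sum>b\<in>set R. c b * b ! j)"
    using assms(3) by (auto simp: inNspan_def)
  have "\<forall>b\<in>set R. \<exists>i<length R. R ! i = b" by (simp add: in_set_conv_nth)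
  \<comment> \<open>One index is chosen for each vector, so that a repeated entry receives its
    coefficient once.\<close>
  then obtain \<iota> where \<iota>: "\<forall>b\<in>set R. \<iota> b < length R \<and> R ! \<iota> b = b" by metis
  define w where "w = (\<Sum>b\<in>set R. single (\<iota> b) (c b))"
  have "keys w \<subseteq> (\<Union>b\<in>set R. keys (single (\<iota> b) (c b)))"
    unfolding w_def by (rule keys_sum)
  then have "keys w \<subseteq> {..<length R}" using \<iota> by (fastforce split: if_splits)
  moreover have "tdeg R w j = nth_default 0 a j" for j
  proof -
    have sum: "tdeg R (\<Sum>b\<in>X. f b) j = (\<Sum>b\<in>X. tdeg R (f b) j)" for X :: "nat list set" and f
      by (induction X rule: infinite_finite_induct) (auto simp: tdeg_add)
    have "tdeg R w j = (\<Sum>b\<in>set R. c b * nth_default 0 b j)"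
      unfolding w_def sum using \<iota> by (intro sum.cong) (auto simp: tdeg_single)
    also have "\<dots> = nth_default 0 a j"
      using c assms(1,2) by (auto simp: nth_default_def)
    finally show ?thesis .
  qed
  ultimately show thesis using that by blast
qed

section \<open>The reduction\<close>

lemma toric_ci_iff_mu:
  "wf_vecs m A \<Longrightarrow> toric_ci TYPE('k::field) m A \<longleftrightarrow> mu TYPE('k) A = length A - lattice_rank m A"
  by (simp add: toric_ci_def min_gens_eq_mu)

lemma wf_vecs_lengthD: "wf_vecs m A \<Longrightarrow> \<forall>a\<in>set A. length a = m"
  by (simp add: wf_vecs_def)

lemma red_step_wf:
  assumes "wf_vecs m R" "a \<in> set R"
  shows "wf_vecs m (red_step m a R)"
proof -
  have wf: "wf_vecs m (remove1 a R @ [a])"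
    using assms wf_vecs_mset_cong[of R "remove1 a R @ [a]"] by simp
  show ?thesis
  proof (cases "inQspan m (set (remove1 a R)) a")
    case True
    have "minB m (set (remove1 a R)) a > 0"
      by (rule minB_props(1)) (use wf True in auto)
    then show ?thesis using wf wf_vecs_scaleN[OF wf] by (simp add: red_step_def Let_def)
  next
    case False
    then show ?thesis using wf by (simp add: red_step_def)
  qed
qed

text \<open>Compare \<open>R\<close> with the result. If \<open>a\<close> is outside the rational
  span, length and rank both drop by one and \<open>mu\<close> stays. If \<open>B a\<close> is put
  back, all three stay. If \<open>B a\<close> is in the semigroup, length and \<open>mu\<close> drop
  by one and the rank stays. In every case \<open>mu\<close> and the height change equally.\<close>

lemma toric_ci_red_step:
  assumes "wf_vecs m R" "a \<in> set R"
  shows "toric_ci TYPE('k::field) m (red_step m a R) \<longleftrightarrow> toric_ci TYPE('k) m R"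
proof -
  define R' where "R' = remove1 a R"
  define B where "B = minB m (set R') a"
  have ms: "mset (R' @ [a]) = mset R" using assms(2) by (simp add: R'_def)
  have wf: "wf_vecs m (R' @ [a])" using assms(1) wf_vecs_mset_cong[OF ms] by simp
  then have wf': "wf_vecs m R'" and la: "length a = m" by auto
  have len: "length R = Suc (length R')" using mset_eq_length[OF ms] by simp
  have rk: "lattice_rank m R = lattice_rank m (R' @ [a])"
    by (rule lattice_rank_set_cong) (metis ms set_mset_mset)
  have ci: "toric_ci TYPE('k) m R \<longleftrightarrow>
      mu TYPE('k) (R' @ [a]) = Suc (length R') - lattice_rank m (R' @ [a])"
    using toric_ci_iff_mu[OF assms(1), where ?'k = 'k] mu_mset_cong[OF assms(1) ms, where ?'k = 'k] len rk by simp
  have step: "red_step m a R = (if inQspan m (set R') a \<and> \<not> inNspan m (set R') (scaleN B a)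
      then R' @ [scaleN B a] else R')"
    by (simp add: red_step_def R'_def B_def Let_def)
  show ?thesis
  proof (cases "inQspan m (set R') a")
    case False
    have "lookup u (length R') = lookup v (length R')" if "equideg (R' @ [a]) u v" for u v
      using int_mult_in_imp_inQspan[OF equideg_imp_int_mult_in[OF wf that]] False by auto
    then have "mu TYPE('k) (R' @ [a]) = mu TYPE('k) R'" by (rule mu_append_free[OF wf])
    moreover have "lattice_rank m (R' @ [a]) = Suc (lattice_rank m R')"
      by (rule lattice_rank_append_notin[OF wf_vecs_lengthD[OF wf] False])
    ultimately show ?thesis using False ci toric_ci_iff_mu[OF wf', where ?'k = 'k] step by simp
  next
    case True
    note B = minB_props[OF la finite_set True, folded B_def]
    have wfB: "wf_vecs m (R' @ [scaleN B a])" by (rule wf_vecs_scaleN[OF wf B(1)])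
    have mu: "mu TYPE('k) (R' @ [scaleN B a]) = mu TYPE('k) (R' @ [a])"
      using equideg_mod_minB[OF wf True] by (intro mu_append_scale[OF wf B(1)]) (simp add: B_def)
    have r: "lattice_rank m (R' @ [a]) = lattice_rank m R'"
      by (rule lattice_rank_append_in[OF wf_vecs_lengthD[OF wf] True])
    \<comment> \<open>With multiplier 1, membership of \<open>B a\<close> in the lattice becomes
      membership in the rational span, which keeps the rank.\<close>
    have "int_mult_in m (set R') (scaleN B a) 1"
      using B(2) inZspan_scaleN_iff[OF la] by (simp add: int_mult_in_def inZspan_def)
    then have "inQspan m (set R') (scaleN B a)" by (rule int_mult_in_imp_inQspan) simp
    then have rB: "lattice_rank m (R' @ [scaleN B a]) = lattice_rank m R'"
      by (rule lattice_rank_append_in[OF wf_vecs_lengthD[OF wfB]])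
    show ?thesis
    proof (cases "inNspan m (set R') (scaleN B a)")
      case False
      then show ?thesis
        using True step ci toric_ci_iff_mu[OF wfB, where ?'k = 'k] mu r rB by simp
    next
      case N: True
      obtain w where w: "keys w \<subseteq> {..<length R'}" "\<And>j. tdeg R' w j = nth_default 0 (scaleN B a) j"
        using inNspan_exponent[OF wf_vecs_lengthD[OF wf'] _ N] wfB by auto
      interpret redundant_last m R' "scaleN B a" w
        by unfold_locales (use wfB w in auto)
      have "mu TYPE('k) (R' @ [a]) = Suc (mu TYPE('k) R')"
        using mu_append_redundant[where ?'k = 'k] mu by simp
      moreover have "lattice_rank m R' \<le> length R'"
        by (rule lattice_rank_le_length[OF wf_vecs_lengthD[OF wf']])
      ultimately show ?thesis
        using N step ci toric_ci_iff_mu[OF wf', where ?'k = 'k] r by (simp add: Suc_diff_le)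
    qed
  qed
qed

text \<open>The invariant compares multisets: the vectors still to be processed remain in the
  current list with their multiplicities, because a step removes one copy of \<open>a\<close> and
  otherwise only appends.\<close>

lemma toric_ci_fold_red_step:
  assumes "wf_vecs m R" "mset G \<subseteq># mset R"
  shows "wf_vecs m (fold (red_step m) G R) \<and>
    (toric_ci TYPE('k::field) m (fold (red_step m) G R) \<longleftrightarrow> toric_ci TYPE('k) m R)"
  using assms
proof (induction G arbitrary: R)
  case (Cons a G)
  then have a: "a \<in> set R" by (metis insert_subset_eq_iff mset.simps(2) set_mset_mset)
  have "mset G \<subseteq># mset (remove1 a R)"
    using Cons.prems(2) by (simp add: insert_subset_eq_iff)
  also have "mset (remove1 a R) \<subseteq># mset (red_step m a R)"
    by (simp add: red_step_def Let_def)
  finally show ?case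
    using Cons.IH[OF red_step_wf[OF Cons.prems(1) a]] toric_ci_red_step[OF Cons.prems(1) a, where ?'k = 'k]
    by simp
qed simp

lemma toric_ci_red_pass_iterate:
  assumes "wf_vecs m A"
  shows "wf_vecs m ((red_pass m ^^ k) A) \<and>
    (toric_ci TYPE('k::field) m ((red_pass m ^^ k) A) \<longleftrightarrow> toric_ci TYPE('k) m A)"
proof (induction k)
  case (Suc k)
  let ?R = "(red_pass m ^^ k) A"
  have "(red_pass m ^^ Suc k) A = fold (red_step m) ?R ?R" by (simp add: red_pass_def[of m ?R])
  then show ?case using Suc toric_ci_fold_red_step[of m ?R ?R, where ?'k = 'k] by simp
qed (use assms in simp)

text \<open>Makes the alternative \<open>reduced m A = []\<close> agree with the invariant: without
  variables every binomial is 0, so no generators are needed, and the height is 0.\<close>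

lemma toric_ci_Nil: "toric_ci TYPE('k::field) m []"
proof -
  have wf: "wf_vecs m []" by (simp add: wf_vecs_def)
  have "bin u v = (0 :: 'k mpol)" if "equideg [] u v" for u v
    using that by (simp add: equideg_def)
  then have "bins [] \<subseteq> {0 :: 'k mpol}" by (auto simp: bins_def)
  then have "spans_mod [] ({} :: 'k mpol set)"
    unfolding spans_mod_def using vs.span_zero by auto
  then have "mu TYPE('k) [] = 0" using mu_le by fastforce
  then show ?thesis by (simp add: toric_ci_iff_mu[OF wf])
qed

theorem mainTheorem5:
  fixes A :: "nat list list" and m :: nat
  assumes "\<forall>a\<in>set A. length a = m"
    and "\<forall>a\<in>set A. a \<noteq> replicate m 0"
  shows "toric_ci TYPE('k::field) m A \<longleftrightarrow>
           (reduced m A = [] \<or> toric_ci TYPE('k) m (reduced m A))"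
proof -
  have "wf_vecs m A" using assms by (simp add: wf_vecs_def)
  \<comment> \<open>By definition \<open>reduced\<close> is an iterate of \<open>red_pass\<close>,
    and the equivalence holds for every iterate.\<close>
  moreover obtain k where "reduced m A = (red_pass m ^^ k) A"
    by (auto simp: reduced_def Let_def)
  ultimately have "toric_ci TYPE('k) m (reduced m A) \<longleftrightarrow> toric_ci TYPE('k) m A"
    using toric_ci_red_pass_iterate by metis
  then show ?thesis using toric_ci_Nil by metis
qed

end
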